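(* Let $\mathfrak{A}$ be a unital JB$^*$-algebra, and suppose that $\psi:\mathfrak{A}\to\mathbb{C}$ is a non-zero Jordan $^*$-homomorphism. Consider the unital real JB$^*$-algebra $\mathfrak{A}_{\mathbb{R}}^{\psi}:=\psi^{-1}(\mathbb{R})$. Then $\frac12\mathcal{B}_{\mathfrak{A}_{\mathbb{R}}^{\psi}}$ is contained in the norm-closed convex hull of the unitary elements of $\mathfrak{A}_{\mathbb{R}}^{\psi}$, and consequently every convex body $K\subseteq\mathfrak{A}_{\mathbb{R}}^{\psi}$ satisfies the strong Mankiewicz property.
   Context: A JB$^*$-algebra is a complex Jordan algebra $\mathfrak{A}$ (product $\circ$ commutative with $(x\circ y)\circ x^2=x\circ(y\circ x^2)$) with a complete norm satisfying $\|a\circ b\|\le\|a\|\,\|b\|$ and an algebra involution $^*$ with $\|U_a(a^* )\|=\|a\|^3$, where $U_a(b)=2(a\circ b)\circ a-a^2\circ b$. A Jordan $^*$-homomorphism is a linear map preserving Jordan products and involutions. A real JB$^*$-algebra is a norm-closed $^*$-invariant real (Jordan) subalgebra of a JB$^*$-algebra. An element $u$ is unitary if it is invertible with inverse $u^*$, i.e. $u\circ u^*=\mathbf{1}$ and $u^2\circ u^*=u$, where $\mathbf{1}$ is the unit. $\mathcal{B}_X$ is the closed unit ball of $X$. A convex body in a normed space $X$ is a convex subset of $X$ with non-empty interior in $X$. A convex subset $K$ of a normed space has the strong Mankiewicz property if every surjective isometry from $K$ onto an arbitrary convex subset $L$ of a normed space $Y$ is affine. *)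

theory Defs
  imports "HOL-Analysis.Analysis"
begin

section \<open>Complex Jordan *-algebras\<close>

class complex_vector = real_vector +
  fixes scaleC :: "complex \<Rightarrow> 'a \<Rightarrow> 'a"  (infixr "*\<^sub>C" 75)
  assumes scaleC_add_right: "c *\<^sub>C (x + y) = c *\<^sub>C x + c *\<^sub>C y"
    and scaleC_add_left: "(c + d) *\<^sub>C x = c *\<^sub>C x + d *\<^sub>C x"
    and scaleC_scaleC: "c *\<^sub>C d *\<^sub>C x = (c * d) *\<^sub>C x"
    and scaleC_of_real: "complex_of_real r *\<^sub>C x = r *\<^sub>R x"

class complex_jordan_algebra = complex_vector +
  fixes jordan :: "'a \<Rightarrow> 'a \<Rightarrow> 'a"  (infixl "\<circ>\<^sub>J" 70)
  assumes jordan_commute: "x \<circ>\<^sub>J y = y \<circ>\<^sub>J x"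
    and jordan_add_left: "(x + y) \<circ>\<^sub>J z = x \<circ>\<^sub>J z + y \<circ>\<^sub>J z"
    and jordan_scaleC_left: "(c *\<^sub>C x) \<circ>\<^sub>J y = c *\<^sub>C (x \<circ>\<^sub>J y)"
    and jordan_identity: "(x \<circ>\<^sub>J y) \<circ>\<^sub>J (x \<circ>\<^sub>J x) = x \<circ>\<^sub>J (y \<circ>\<^sub>J (x \<circ>\<^sub>J x))"
begin

definition jordan_U :: "'a \<Rightarrow> 'a \<Rightarrow> 'a"
  where "jordan_U a b = 2 *\<^sub>R ((a \<circ>\<^sub>J b) \<circ>\<^sub>J a) - (a \<circ>\<^sub>J a) \<circ>\<^sub>J b"

end

class complex_jordan_star_algebra = complex_jordan_algebra +
  fixes star :: "'a \<Rightarrow> 'a"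
  assumes star_star: "star (star x) = x"
    and star_add: "star (x + y) = star x + star y"
    and star_scaleC: "star (c *\<^sub>C x) = cnj c *\<^sub>C star x"
    and star_jordan: "star (x \<circ>\<^sub>J y) = star y \<circ>\<^sub>J star x"

section \<open>JB*-algebras\<close>

class jb_star_algebra = complex_jordan_star_algebra + banach +
  assumes norm_scaleC: "norm (c *\<^sub>C x) = cmod c * norm x"
    and norm_jordan_le: "norm (x \<circ>\<^sub>J y) \<le> norm x * norm y"
    and norm_jordan_U_star: "norm (jordan_U x (star x)) = norm x ^ 3"

class unital_jb_star_algebra = jb_star_algebra + one +
  assumes jordan_one_left: "1 \<circ>\<^sub>J x = x"

instantiation complex :: complex_jordan_star_algebra
begin

definition scaleC_complex :: "complex \<Rightarrow> complex \<Rightarrow> complex"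
  where "scaleC_complex c z = c * z"

definition jordan_complex :: "complex \<Rightarrow> complex \<Rightarrow> complex"
  where "jordan_complex w z = w * z"

definition star_complex :: "complex \<Rightarrow> complex"
  where "star_complex z = cnj z"

instance
  by standard (simp_all add: scaleC_complex_def jordan_complex_def star_complex_def
      algebra_simps scaleR_conv_of_real)

end

instance complex :: unital_jb_star_algebra
proof
  fix x :: complex
  have "2 *\<^sub>R ((x * cnj x) * x) - (x * x) * cnj x = x * x * cnj x"
    by (simp add: scaleR_conv_of_real)
  then have U: "jordan_U x (star x) = x * x * cnj x"
    by (simp only: jordan_U_def jordan_complex_def star_complex_def)
  show "norm (jordan_U x (star x)) = norm x ^ 3"
    unfolding U by (simp add: norm_mult power3_eq_cube)
qed (simp_all add: scaleC_complex_def jordan_complex_def norm_mult)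

definition jordan_star_hom ::
    "('a::complex_jordan_star_algebra \<Rightarrow> 'b::complex_jordan_star_algebra) \<Rightarrow> bool"
  where "jordan_star_hom h \<longleftrightarrow>
    (\<forall>x y. h (x + y) = h x + h y) \<and>
    (\<forall>c x. h (c *\<^sub>C x) = c *\<^sub>C h x) \<and>
    (\<forall>x y. h (x \<circ>\<^sub>J y) = h x \<circ>\<^sub>J h y) \<and>
    (\<forall>x. h (star x) = star (h x))"

section \<open>Real JB*-algebras and unitary elements\<close>

text \<open>A real JB*-algebra is represented by its carrier in an ambient JB*-algebra.\<close>

definition real_jb_star_algebra :: "'a::jb_star_algebra set \<Rightarrow> bool"
  where "real_jb_star_algebra A \<longleftrightarrow>
    subspace A \<and> closed A \<and> (\<forall>x\<in>A. \<forall>y\<in>A. x \<circ>\<^sub>J y \<in> A) \<and> (\<forall>x\<in>A. star x \<in> A)"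

definition jordan_inverse :: "'a::unital_jb_star_algebra \<Rightarrow> 'a \<Rightarrow> bool"
  where "jordan_inverse a b \<longleftrightarrow> a \<circ>\<^sub>J b = 1 \<and> (a \<circ>\<^sub>J a) \<circ>\<^sub>J b = a"

text \<open>Meant for \<open>A\<close> a real JB*-algebra containing the ambient unit, which is then the unit
  of \<open>A\<close>; the inverse \<open>star u\<close> lies in \<open>A\<close> automatically.\<close>

definition unitaries :: "'a::unital_jb_star_algebra set \<Rightarrow> 'a set"
  where "unitaries A = {u \<in> A. jordan_inverse u (star u)}"

section \<open>Convex bodies and the strong Mankiewicz property\<close>

text \<open>The interior is taken relative to the normed space \<open>X\<close>, which may be a proper
  subspace of the ambient type.\<close>

definition convex_body :: "'a::real_normed_vector set \<Rightarrow> 'a set \<Rightarrow> bool"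
  where "convex_body X K \<longleftrightarrow>
    K \<subseteq> X \<and> convex K \<and> (top_of_set X) interior_of K \<noteq> {}"

definition affine_map_on :: "'a::real_vector set \<Rightarrow> ('a \<Rightarrow> 'b::real_vector) \<Rightarrow> bool"
  where "affine_map_on K f \<longleftrightarrow>
    (\<forall>x\<in>K. \<forall>y\<in>K. \<forall>t\<in>{0..1}.
      f ((1 - t) *\<^sub>R x + t *\<^sub>R y) = (1 - t) *\<^sub>R f x + t *\<^sub>R f y)"

text \<open>HOL cannot quantify over the type of the target space \<open>Y\<close> inside a definition, so it
  is a type argument \<open>'b\<close>; the property for arbitrary \<open>Y\<close> is obtained by leaving \<open>'b\<close> free
  in the theorem. Complex target spaces are covered through their real structure.\<close>

definition strong_mankiewicz ::
    "'b::real_normed_vector itself \<Rightarrow> 'a::real_normed_vector set \<Rightarrow> bool"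
  where "strong_mankiewicz Y K \<longleftrightarrow>
    (\<forall>(L :: 'b set) f.
      convex L \<longrightarrow> f ` K = L \<longrightarrow> (\<forall>x\<in>K. \<forall>y\<in>K. dist (f x) (f y) = dist x y) \<longrightarrow>
      affine_map_on K f)"

end

theory Submission
  imports Defs "HOL-Computational_Algebra.Fundamental_Theorem_Algebra"
begin

text \<open>A self-adjoint contraction \<open>h\<close> has a continuous functional calculus on \<open>[-1,1]\<close>: the powers of
  \<open>h\<close> generate an associative algebra, and a polynomial positive on \<open>[-1,1]\<close> is a product of factors
  each of which is a square when evaluated at \<open>h\<close>. Write \<open>x = h + \<i>k\<close> with \<open>h, k\<close> self-adjoint;
  then \<open>\<psi> x\<close> is real iff \<open>\<psi> k = 0\<close>. If \<open>\<parallel>x\<parallel> < 1\<close>, then \<open>h\<close> is a convex combination of elements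
  \<open>cos \<theta>(h)\<close> with \<open>\<theta>(\<psi> h) \<in> {0, \<pi>}\<close>, and \<open>\<i>k\<close> is the mean of \<open>exp (\<i>f)\<close> and \<open>- exp (- \<i>f)\<close> with
  \<open>f = arcsin k\<close>, so \<open>x/2\<close> is a convex combination of unitaries on which \<open>\<psi>\<close> is \<open>\<plusminus>1\<close>.

  These unitaries \<open>u\<close> are extreme points of the unit ball, so \<open>x\<close> is the only metric midpoint
  of \<open>x \<plusminus> tu\<close>. Hence an isometry onto a convex set preserves midpoints in the directions \<open>u\<close>, then
  in the directions of sums of multiples of them, which fill a ball.\<close>

section \<open>Jordan algebras and power associativity\<close>

text \<open>The axioms do not make the involution isometric, so
  \<open>norm (real_part x) \<le> norm x\<close> is not a triangle inequality. It is obtained to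
  first order at the unit: \<open>1 + t x\<close> is multiplied by a contraction that removes the
  imaginary part up to \<open>O(t\<^sup>2)\<close>. The bound serves twice, for the extremality of
  \<open>1\<close> and to keep \<open>h\<close> and \<open>k\<close> in the range of the calculus.
  Squares take the place of positive elements and [-1,1] that of the spectrum: a bound
  \<open>|p| \<le> M\<close> on [-1,1] passes to \<open>p(h)\<close> because
  \<open>(M + e)\<^sup>2 - p\<^sup>2\<close> evaluates to a square. The factor 1/2 is the price of
  treating \<open>h\<close> and \<open>\<i>k\<close> separately: each lies in the hull, and their
  midpoint is \<open>x/2\<close>. The open half ball lies in the hull itself and not just in its
  closure; the midpoint argument adds one direction at a time and so needs finite
  combinations.\<close>

lemma jordan_add_right: "(x :: 'a::complex_jordan_algebra) \<circ>\<^sub>J (y + z) = x \<circ>\<^sub>J y + x \<circ>\<^sub>J z"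
  by (metis jordan_add_left jordan_commute)

lemma jordan_scaleC_right: "(x :: 'a::complex_jordan_algebra) \<circ>\<^sub>J (c *\<^sub>C y) = c *\<^sub>C (x \<circ>\<^sub>J y)"
  by (metis jordan_scaleC_left jordan_commute)

lemma jordan_scaleR_left: "(r *\<^sub>R x) \<circ>\<^sub>J (y :: 'a::complex_jordan_algebra) = r *\<^sub>R (x \<circ>\<^sub>J y)"
  by (metis jordan_scaleC_left scaleC_of_real)

lemma jordan_scaleR_right: "(x :: 'a::complex_jordan_algebra) \<circ>\<^sub>J (r *\<^sub>R y) = r *\<^sub>R (x \<circ>\<^sub>J y)"
  by (metis jordan_scaleR_left jordan_commute)

lemma jordan_minus_left: "(- x) \<circ>\<^sub>J (y :: 'a::complex_jordan_algebra) = - (x \<circ>\<^sub>J y)"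
  using jordan_scaleR_left[of "-1" x y] by simp

lemma jordan_minus_right: "(x :: 'a::complex_jordan_algebra) \<circ>\<^sub>J (- y) = - (x \<circ>\<^sub>J y)"
  using jordan_scaleR_right[of x "-1" y] by simp

lemma jordan_diff_left: "(x - y) \<circ>\<^sub>J (z :: 'a::complex_jordan_algebra) = x \<circ>\<^sub>J z - y \<circ>\<^sub>J z"
  using jordan_add_left[of x "- y" z] by (simp add: jordan_minus_left)

lemma jordan_diff_right: "(x :: 'a::complex_jordan_algebra) \<circ>\<^sub>J (y - z) = x \<circ>\<^sub>J y - x \<circ>\<^sub>J z"
  using jordan_add_right[of x y "- z"] by (simp add: jordan_minus_right)

lemma jordan_zero_left [simp]: "0 \<circ>\<^sub>J (x :: 'a::complex_jordan_algebra) = 0"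
  using jordan_scaleR_left[of 0 0 x] by simp

lemma jordan_zero_right [simp]: "(x :: 'a::complex_jordan_algebra) \<circ>\<^sub>J 0 = 0"
  using jordan_scaleR_right[of x 0 0] by simp

lemma scaleC_one [simp]: "1 *\<^sub>C (x :: 'a::complex_vector) = x"
  using scaleC_of_real[of 1 x] by simp

lemma scaleC_zero_right [simp]: "c *\<^sub>C (0 :: 'a::complex_vector) = 0"
  using scaleC_add_right[of c 0 "0::'a"] by simp

lemma scaleC_minus_right: "c *\<^sub>C (- (x :: 'a::complex_vector)) = - (c *\<^sub>C x)"
  using scaleC_add_right[of c x "- x"] by (simp add: eq_neg_iff_add_eq_0 add.commute)

lemma scaleC_minus_left: "(- c) *\<^sub>C (x :: 'a::complex_vector) = - (c *\<^sub>C x)"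
  using scaleC_add_left[of c "- c" x] scaleC_of_real[of 0 x]
  by (simp add: eq_neg_iff_add_eq_0 add.commute)

lemma scaleC_diff_right: "c *\<^sub>C (x - (y :: 'a::complex_vector)) = c *\<^sub>C x - c *\<^sub>C y"
  using scaleC_add_right[of c x "- y"] by (simp add: scaleC_minus_right)

lemma scaleC_scaleR: "c *\<^sub>C r *\<^sub>R (x :: 'a::complex_vector) = r *\<^sub>R c *\<^sub>C x"
  by (metis scaleC_of_real scaleC_scaleC mult.commute)

lemma ii_scaleC_ii: "\<i> *\<^sub>C \<i> *\<^sub>C (x :: 'a::complex_vector) = - x"
  by (simp add: scaleC_scaleC scaleC_minus_left)

lemmas jordan_bilinear = jordan_add_left jordan_add_right jordan_diff_left jordan_diff_right
  jordan_minus_left jordan_minus_right jordan_scaleR_left jordan_scaleR_right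
  jordan_scaleC_left jordan_scaleC_right

lemma jordan_one_right [simp]: "x \<circ>\<^sub>J 1 = (x :: 'a::unital_jb_star_algebra)"
  by (metis jordan_one_left jordan_commute)

declare jordan_one_left [simp]

lemma star_scaleR: "star (r *\<^sub>R x) = r *\<^sub>R star (x :: 'a::complex_jordan_star_algebra)"
  by (metis star_scaleC scaleC_of_real complex_cnj_complex_of_real)

lemma star_zero [simp]: "star (0 :: 'a::complex_jordan_star_algebra) = 0"
  using star_scaleR[of 0 "0::'a"] by simp

lemma star_minus: "star (- x) = - star (x :: 'a::complex_jordan_star_algebra)"
  using star_scaleR[of "-1" x] by simp

lemma star_diff: "star (x - y) = star x - star (y :: 'a::complex_jordan_star_algebra)"
  using star_add[of x "- y"] by (simp add: star_minus)

lemma star_one [simp]: "star 1 = (1 :: 'a::unital_jb_star_algebra)"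
  by (metis jordan_one_right star_jordan star_star)

text \<open>Evaluating U at the unit gives \<open>n = n ^ 3\<close> for its norm \<open>n\<close>,
  so \<open>n\<close> is 0 or 1. The zero algebra is a model, whence the inequality.\<close>

lemma norm_one_le: "norm (1 :: 'a::unital_jb_star_algebra) \<le> 1"
proof -
  have "jordan_U 1 (star 1) = (1 :: 'a)"
    by (simp add: jordan_U_def scaleR_2)
  then have "norm (1::'a) = norm (1::'a) ^ 3"
    using norm_jordan_U_star[of "1::'a"] by simp
  then show ?thesis
    by (metis linorder_not_le norm_ge_zero numeral_less_iff one_less_numeral_iff
      order_less_irrefl power_one_right power_strict_increasing_iff semiring_norm(77))
qed

interpretation jordan: bounded_bilinear
  "(\<circ>\<^sub>J) :: 'a::jb_star_algebra \<Rightarrow> 'a \<Rightarrow> 'a"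
  by (rule bounded_bilinear.intro) (auto simp: jordan_bilinear norm_jordan_le intro!: exI[of _ 1])

text \<open>The U-axiom at \<open>star x\<close> gives \<open>n ^ 3 \<le> 3 * n\<^sup>2 * m\<close>,
  where 3 = 2 + 1 counts the terms of U. Continuity is what is wanted: it lets self-adjointness pass
  to closures.\<close>

lemma norm_star_le: "norm (star x) \<le> 3 * norm (x :: 'a::jb_star_algebra)"
proof (cases "star x = 0")
  case False
  define n m where "n = norm (star x)" and "m = norm x"
  have n: "n > 0" using False by (simp add: n_def)
  have "n ^ 3 = norm (2 *\<^sub>R ((star x \<circ>\<^sub>J x) \<circ>\<^sub>J star x) - (star x \<circ>\<^sub>J star x) \<circ>\<^sub>J x)"
    using norm_jordan_U_star[of "star x"] by (simp add: n_def jordan_U_def star_star)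
  also have "\<dots> \<le> norm (2 *\<^sub>R ((star x \<circ>\<^sub>J x) \<circ>\<^sub>J star x)) + norm ((star x \<circ>\<^sub>J star x) \<circ>\<^sub>J x)"
    by (rule norm_triangle_ineq4)
  also have "\<dots> \<le> 2 * ((n * m) * n) + (n * n) * m"
    unfolding n_def m_def norm_scaleR
    by (intro add_mono mult_mono order_trans[OF norm_jordan_le]) (auto intro: norm_jordan_le)
  finally have "n\<^sup>2 * n \<le> n\<^sup>2 * (3 * m)"
    by (simp add: power2_eq_square power3_eq_cube algebra_simps)
  then have "n \<le> 3 * m"
    using n by (simp add: mult_le_cancel_left_pos)
  then show ?thesis by (simp add: n_def m_def)
qed simp

lemma bounded_linear_star: "bounded_linear (star :: 'a::jb_star_algebra \<Rightarrow> 'a)"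
  by (rule bounded_linear_intro[where K = 3])
    (auto simp: star_add star_scaleR intro: norm_star_le order_trans[OF norm_star_le])

section \<open>Commuting multiplications by powers of one element\<close>

lemma jordan_linearized:
  fixes x y z :: "'a::complex_jordan_algebra"
  shows "((x \<circ>\<^sub>J x) \<circ>\<^sub>J y) \<circ>\<^sub>J z =
    (x \<circ>\<^sub>J x) \<circ>\<^sub>J (y \<circ>\<^sub>J z) + 2 *\<^sub>R ((x \<circ>\<^sub>J y) \<circ>\<^sub>J (x \<circ>\<^sub>J z)) - 2 *\<^sub>R (x \<circ>\<^sub>J (y \<circ>\<^sub>J (x \<circ>\<^sub>J z)))"
proof -
  define G where "G x = (x \<circ>\<^sub>J y) \<circ>\<^sub>J (x \<circ>\<^sub>J x) - x \<circ>\<^sub>J (y \<circ>\<^sub>J (x \<circ>\<^sub>J x))" for x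
  have G: "G v = 0" for v by (simp add: G_def jordan_identity)
  \<comment> \<open>\<open>G\<close> is cubic, and the part of \<open>G (x + z)\<close> that is odd
    in \<open>z\<close> consists of a linear term and \<open>G z\<close>. The combination on the
    right leaves twice the linear term.\<close>
  have "2 *\<^sub>R ((z \<circ>\<^sub>J y) \<circ>\<^sub>J (x \<circ>\<^sub>J x) + 2 *\<^sub>R ((x \<circ>\<^sub>J y) \<circ>\<^sub>J (x \<circ>\<^sub>J z)) - z \<circ>\<^sub>J (y \<circ>\<^sub>J (x \<circ>\<^sub>J x))
      - 2 *\<^sub>R (x \<circ>\<^sub>J (y \<circ>\<^sub>J (x \<circ>\<^sub>J z)))) = G (x + z) - G (x - z) - 2 *\<^sub>R G z"
    unfolding G_def scaleR_2
    by (simp add: jordan_bilinear jordan_commute[of z x] algebra_simps)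
  then have "(z \<circ>\<^sub>J y) \<circ>\<^sub>J (x \<circ>\<^sub>J x) + 2 *\<^sub>R ((x \<circ>\<^sub>J y) \<circ>\<^sub>J (x \<circ>\<^sub>J z)) - z \<circ>\<^sub>J (y \<circ>\<^sub>J (x \<circ>\<^sub>J x))
      - 2 *\<^sub>R (x \<circ>\<^sub>J (y \<circ>\<^sub>J (x \<circ>\<^sub>J z))) = 0"
    unfolding G by simp
  then show ?thesis
    by (simp add: jordan_commute[of z] jordan_commute[of y "x \<circ>\<^sub>J x"]
       jordan_commute[of "y \<circ>\<^sub>J z"] algebra_simps)
qed

primrec jordan_power :: "'a::unital_jb_star_algebra \<Rightarrow> nat \<Rightarrow> 'a" where
  "jordan_power x 0 = 1"
| "jordan_power x (Suc n) = x \<circ>\<^sub>J jordan_power x n"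

lemma jordan_square_power: "(x \<circ>\<^sub>J x) \<circ>\<^sub>J jordan_power x n = jordan_power x (Suc (Suc n))"
proof (induction n)
  case (Suc n)
  have "(x \<circ>\<^sub>J x) \<circ>\<^sub>J jordan_power x (Suc n) = x \<circ>\<^sub>J ((x \<circ>\<^sub>J x) \<circ>\<^sub>J jordan_power x n)"
    using jordan_identity[of x "jordan_power x n"] by (simp add: jordan_commute[of "x \<circ>\<^sub>J x"])
  then show ?case using Suc by simp
qed simp

text \<open>By the linearized Jordan identity, multiplication by a power of \<open>x\<close> is a polynomial in the
  multiplications by \<open>x\<close> and \<open>x \<circ>\<^sub>J x\<close>.\<close>

lemma commute_jordan_power:
  assumes "linear T"
    and T1: "\<And>z. T (x \<circ>\<^sub>J z) = x \<circ>\<^sub>J T z"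
    and T2: "\<And>z. T ((x \<circ>\<^sub>J x) \<circ>\<^sub>J z) = (x \<circ>\<^sub>J x) \<circ>\<^sub>J T z"
  shows "T (jordan_power x n \<circ>\<^sub>J z) = jordan_power x n \<circ>\<^sub>J T z"
proof (induction n arbitrary: z rule: induct_nat_012)
  case (ge2 n)
  interpret linear T by fact
  note IH = ge2.IH(1) ge2.IH(2)[simplified]
  show ?case
    unfolding jordan_square_power[symmetric] jordan_linearized
    by (simp add: add diff scale T1 T2 IH)
qed (simp_all add: T1)

lemma linear_jordan: "linear ((\<circ>\<^sub>J) (x :: 'a::complex_jordan_algebra))"
  by (rule linearI) (simp_all add: jordan_bilinear)

text \<open>By the Jordan identity, multiplications by \<open>x\<close> and by
  \<open>x \<circ>\<^sub>J x\<close> commute. \<open>commute_jordan_power\<close> first transfers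
  this to powers against each of these two, then to powers against powers.\<close>

lemma jordan_power_operator_commute:
  "jordan_power x m \<circ>\<^sub>J (jordan_power x n \<circ>\<^sub>J z) = jordan_power x n \<circ>\<^sub>J (jordan_power x m \<circ>\<^sub>J z)"
proof (rule commute_jordan_power[OF linear_jordan])
  have sq: "x \<circ>\<^sub>J ((x \<circ>\<^sub>J x) \<circ>\<^sub>J z) = (x \<circ>\<^sub>J x) \<circ>\<^sub>J (x \<circ>\<^sub>J z)" for z
    using jordan_identity[of x z] by (simp add: jordan_commute[of "x \<circ>\<^sub>J x"])
  show "jordan_power x m \<circ>\<^sub>J (x \<circ>\<^sub>J z) = x \<circ>\<^sub>J (jordan_power x m \<circ>\<^sub>J z)" for z
    by (rule commute_jordan_power[OF linear_jordan, symmetric]) (simp_all add: sq)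
  show "jordan_power x m \<circ>\<^sub>J ((x \<circ>\<^sub>J x) \<circ>\<^sub>J z) = (x \<circ>\<^sub>J x) \<circ>\<^sub>J (jordan_power x m \<circ>\<^sub>J z)" for z
    by (rule commute_jordan_power[OF linear_jordan, symmetric]) (simp_all add: sq)
qed

text \<open>The commutation law lets \<open>z\<close> range over the whole algebra: \<open>B\<close>
  is only a real subspace, and norms of elements \<open>a + \<i> *\<^sub>C b\<close> outside it have
  to be estimated. Associativity inside \<open>B\<close> follows by commutativity in
  \<open>mult_assoc\<close>.\<close>

locale hermitian_algebra =
  fixes B :: "'a::unital_jb_star_algebra set"
  assumes subspace: "subspace B"
    and closed: "closed B"
    and one: "1 \<in> B"
    and mult: "x \<in> B \<Longrightarrow> y \<in> B \<Longrightarrow> x \<circ>\<^sub>J y \<in> B"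
    and operator_commute: "x \<in> B \<Longrightarrow> y \<in> B \<Longrightarrow> x \<circ>\<^sub>J (y \<circ>\<^sub>J z) = y \<circ>\<^sub>J (x \<circ>\<^sub>J z)"
    and hermitian: "x \<in> B \<Longrightarrow> star x = x"

definition generated :: "'a::unital_jb_star_algebra \<Rightarrow> 'a set" where
  "generated h = closure (span (range (jordan_power h)))"

text \<open>Bilinearity carries the rules for powers to their span; continuity of the product and of
  the involution carries them to the closure.\<close>

lemma generated_hermitian_algebra:
  fixes h :: "'a::unital_jb_star_algebra"
  assumes h: "star h = h"
  shows "hermitian_algebra (generated h)"
proof
  let ?P = "range (jordan_power h)"
  let ?S = "span ?P"
  have comm_span: "x \<circ>\<^sub>J (y \<circ>\<^sub>J z) = y \<circ>\<^sub>J (x \<circ>\<^sub>J z)" if "x \<in> ?S" "y \<in> ?S" for x y z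
    using that(2)
  proof (induction rule: span_induct_alt)
    case (step c b y)
    have "x \<circ>\<^sub>J (b \<circ>\<^sub>J z) = b \<circ>\<^sub>J (x \<circ>\<^sub>J z)"
      using that(1)
    proof (induction rule: span_induct_alt)
      case (step d a x)
      then show ?case using \<open>b \<in> ?P\<close>
        by (auto simp: jordan_bilinear jordan_power_operator_commute)
    qed simp
    then show ?case using step by (simp add: jordan_bilinear)
  qed simp
  have pow: "jordan_power h m \<circ>\<^sub>J jordan_power h n = jordan_power h (m + n)" for m n
  proof (induction m)
    case (Suc m)
    have "h = jordan_power h 1" by simp
    then have "jordan_power h n \<circ>\<^sub>J (h \<circ>\<^sub>J jordan_power h m) = h \<circ>\<^sub>J (jordan_power h n \<circ>\<^sub>J jordan_power h m)"
      by (metis jordan_power_operator_commute)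
    then show ?case using Suc by (simp add: jordan_commute)
  qed simp
  have mult_span: "x \<circ>\<^sub>J y \<in> ?S" if "x \<in> ?S" "y \<in> ?S" for x y
    using that(2)
  proof (induction rule: span_induct_alt)
    case (step c b y)
    have "x \<circ>\<^sub>J b \<in> ?S"
      using that(1)
    proof (induction rule: span_induct_alt)
      case (step d a x)
      then have "a \<circ>\<^sub>J b \<in> ?S" using \<open>b \<in> ?P\<close> by (auto simp: pow intro: span_base)
      then show ?case using step by (simp add: jordan_bilinear span_add span_scale)
    qed (simp add: span_zero)
    then show ?case using step by (simp add: jordan_bilinear span_add span_scale)
  qed (simp add: span_zero)
  have approx: "\<exists>X. (\<forall>n. X n \<in> ?S) \<and> X \<longlonglongrightarrow> x" if "x \<in> generated h" for x
    using that unfolding generated_def closure_sequential .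
  show "subspace (generated h)"
  proof (rule subspaceI)
    show "0 \<in> generated h"
      unfolding generated_def by (rule closure_subset[THEN subsetD]) (rule span_zero)
    show "x + y \<in> generated h" if "x \<in> generated h" "y \<in> generated h" for x y
    proof -
      obtain X where X: "\<And>n. X n \<in> ?S" "X \<longlonglongrightarrow> x"
        using approx[OF \<open>x \<in> generated h\<close>] by blast
      obtain Y where Y: "\<And>n. Y n \<in> ?S" "Y \<longlonglongrightarrow> y"
        using approx[OF \<open>y \<in> generated h\<close>] by blast
      show ?thesis
        unfolding generated_def closure_sequential
        using tendsto_add[OF X(2) Y(2)] X(1) Y(1)
        by (intro exI[of _ "\<lambda>n. X n + Y n"]) (auto intro: span_add)
    qed
    show "c *\<^sub>R x \<in> generated h" if "x \<in> generated h" for c x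
    proof -
      obtain X where X: "\<And>n. X n \<in> ?S" "X \<longlonglongrightarrow> x"
        using approx[OF \<open>x \<in> generated h\<close>] by blast
      show ?thesis
        unfolding generated_def closure_sequential
        using tendsto_scaleR[OF tendsto_const X(2)] X(1)
        by (intro exI[of _ "\<lambda>n. c *\<^sub>R X n"]) (auto intro: span_scale)
    qed
  qed
  show "closed (generated h)" unfolding generated_def by simp
  show "1 \<in> generated h"
    unfolding generated_def
    by (metis closure_subset in_mono jordan_power.simps(1) rangeI span_base)
  show "x \<circ>\<^sub>J y \<in> generated h" if "x \<in> generated h" "y \<in> generated h" for x y
  proof -
    obtain X where X: "\<And>n. X n \<in> ?S" "X \<longlonglongrightarrow> x"
      using approx[OF \<open>x \<in> generated h\<close>] by blast
    obtain Y where Y: "\<And>n. Y n \<in> ?S" "Y \<longlonglongrightarrow> y"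
      using approx[OF \<open>y \<in> generated h\<close>] by blast
    have "(\<lambda>n. X n \<circ>\<^sub>J Y n) \<longlonglongrightarrow> x \<circ>\<^sub>J y" by (rule jordan.tendsto[OF X(2) Y(2)])
    then show ?thesis
      unfolding generated_def closure_sequential using X(1) Y(1)
      by (intro exI[of _ "\<lambda>n. X n \<circ>\<^sub>J Y n"]) (auto intro: mult_span)
  qed
  show "x \<circ>\<^sub>J (y \<circ>\<^sub>J z) = y \<circ>\<^sub>J (x \<circ>\<^sub>J z)" if "x \<in> generated h" "y \<in> generated h" for x y z
  proof -
    obtain X where X: "\<And>n. X n \<in> ?S" "X \<longlonglongrightarrow> x"
      using approx[OF \<open>x \<in> generated h\<close>] by blast
    obtain Y where Y: "\<And>n. Y n \<in> ?S" "Y \<longlonglongrightarrow> y"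
      using approx[OF \<open>y \<in> generated h\<close>] by blast
    have "(\<lambda>n. X n \<circ>\<^sub>J (Y n \<circ>\<^sub>J z)) \<longlonglongrightarrow> x \<circ>\<^sub>J (y \<circ>\<^sub>J z)"
      by (intro jordan.tendsto X Y tendsto_const)
    moreover have "(\<lambda>n. X n \<circ>\<^sub>J (Y n \<circ>\<^sub>J z)) \<longlonglongrightarrow> y \<circ>\<^sub>J (x \<circ>\<^sub>J z)"
      unfolding comm_span[OF X(1) Y(1)] by (intro jordan.tendsto X Y tendsto_const)
    ultimately show ?thesis by (rule LIMSEQ_unique)
  qed
  show "star x = x" if "x \<in> generated h" for x
  proof -
    have pow: "star (jordan_power h n) = jordan_power h n" for n
      by (induction n) (simp_all add: star_jordan h jordan_commute)
    have "star x = x" if "x \<in> ?S" for x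
      using that
      by (induction rule: span_induct_alt) (auto simp: star_add star_scaleR pow)
    moreover obtain X where X: "\<And>n. X n \<in> ?S" "X \<longlonglongrightarrow> x"
      using approx[OF \<open>x \<in> generated h\<close>] by blast
    ultimately have "X \<longlonglongrightarrow> star x" using bounded_linear.tendsto[OF bounded_linear_star X(2)] by simp
    then show ?thesis using X(2) LIMSEQ_unique by blast
  qed
qed

lemma generator_in_generated: "h \<in> generated h"
proof -
  have "jordan_power h 1 \<in> generated h"
    unfolding generated_def by (rule closure_subset[THEN subsetD], rule span_base) (rule rangeI)
  then show ?thesis by simp
qed

section \<open>Squares in associative hermitian subalgebras\<close>

context hermitian_algebra
begin

lemma B_add: "x \<in> B \<Longrightarrow> y \<in> B \<Longrightarrow> x + y \<in> B"
  and B_diff: "x \<in> B \<Longrightarrow> y \<in> B \<Longrightarrow> x - y \<in> B"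
  and B_scaleR: "x \<in> B \<Longrightarrow> c *\<^sub>R x \<in> B"
  and B_zero: "0 \<in> B"
  using subspace by (auto simp: subspace_add subspace_diff subspace_scale subspace_0)

lemma mult_assoc:
  assumes "x \<in> B" "y \<in> B" "z \<in> B"
  shows "(x \<circ>\<^sub>J y) \<circ>\<^sub>J z = x \<circ>\<^sub>J (y \<circ>\<^sub>J z)"
  using operator_commute[of z x y] assms by (simp add: jordan_commute[of _ z])

text \<open>Multiplications by \<open>z = a + \<i> *\<^sub>C b\<close> and by \<open>star z\<close>
  commute, so \<open>jordan_U z (star z)\<close> collapses to \<open>z \<circ>\<^sub>J w\<close>
  with \<open>w = z \<circ>\<^sub>J star z\<close>. The norm axiom then gives
  \<open>norm z ^ 3 \<le> norm z * norm w\<close>.\<close>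

lemma norm_unit_decomposition:
  assumes a: "a \<in> B" and b: "b \<in> B"
  shows "(norm (a + \<i> *\<^sub>C b))\<^sup>2 \<le> norm (a \<circ>\<^sub>J a + b \<circ>\<^sub>J b)"
proof -
  define z w where "z = a + \<i> *\<^sub>C b" and "w = a \<circ>\<^sub>J a + b \<circ>\<^sub>J b"
  have star: "star z = a - \<i> *\<^sub>C b"
    by (simp add: z_def star_add star_scaleC hermitian a b scaleC_minus_left)
  have "star z \<circ>\<^sub>J (z \<circ>\<^sub>J y) = z \<circ>\<^sub>J (star z \<circ>\<^sub>J y)" for y
    unfolding star unfolding z_def
    by (simp add: jordan_bilinear scaleC_add_right scaleC_diff_right operator_commute[OF a b])
  moreover have zz: "z \<circ>\<^sub>J star z = w"
    unfolding star w_def unfolding z_def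
    by (simp add: jordan_bilinear scaleC_add_right scaleC_diff_right ii_scaleC_ii
        jordan_commute[of b a])
  ultimately have "jordan_U z (star z) = z \<circ>\<^sub>J w"
    unfolding jordan_U_def
    by (simp add: jordan_commute[of w z] jordan_commute[of "z \<circ>\<^sub>J z" "star z"]
        jordan_commute[of "star z" z] scaleR_2)
  then have "norm z ^ 3 \<le> norm z * norm w"
    by (metis norm_jordan_U_star norm_jordan_le)
  then have "norm z * (norm z)\<^sup>2 \<le> norm z * norm w"
    by (simp add: power2_eq_square power3_eq_cube mult.assoc)
  then show ?thesis
    by (cases "z = 0") (auto simp: z_def[symmetric] w_def[symmetric])
qed

text \<open>\<open>a\<close> is the mean of \<open>a + \<i> *\<^sub>C b\<close> and
  \<open>a - \<i> *\<^sub>C b\<close>, which share one sum of squares. With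
  \<open>norm_square\<close> this says that adding a square never lowers the norm of a square, the
  substitute for monotonicity on positive elements.\<close>

lemma norm_square_le:
  assumes a: "a \<in> B" and b: "b \<in> B"
  shows "(norm a)\<^sup>2 \<le> norm (a \<circ>\<^sub>J a + b \<circ>\<^sub>J b)"
proof -
  define m where "m = norm (a \<circ>\<^sub>J a + b \<circ>\<^sub>J b)"
  have mb: "- b \<in> B" using B_diff[OF B_zero b] by simp
  have "norm (a + \<i> *\<^sub>C b) \<le> sqrt m"
    using norm_unit_decomposition[OF a b] by (simp add: m_def real_le_rsqrt)
  moreover have "norm (a + \<i> *\<^sub>C (- b)) \<le> sqrt m"
    using norm_unit_decomposition[OF a mb]
    by (intro real_le_rsqrt) (simp add: m_def jordan_bilinear)
  moreover have "2 *\<^sub>R a = (a + \<i> *\<^sub>C b) + (a + \<i> *\<^sub>C (- b))"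
    by (simp add: scaleC_minus_right scaleR_2)
  then have "2 * norm a \<le> norm (a + \<i> *\<^sub>C b) + norm (a + \<i> *\<^sub>C (- b))"
    by (metis norm_scaleR norm_triangle_ineq abs_numeral)
  ultimately have "norm a \<le> sqrt m" by linarith
  then have "(norm a)\<^sup>2 \<le> (sqrt m)\<^sup>2" by (intro power_mono) auto
  then show ?thesis by (simp add: m_def)
qed

lemma norm_square: "a \<in> B \<Longrightarrow> norm (a \<circ>\<^sub>J a) = (norm a)\<^sup>2"
  using norm_square_le[OF _ B_zero, of a] norm_jordan_le[of a a]
  by (simp add: power2_eq_square)

text \<open>If \<open>(1 - y)\<^sup>2 = 1 - x\<close> then \<open>y\<close> is a fixed point of the contraction \<open>y \<mapsto> (x + y\<^sup>2) / 2\<close>.\<close>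

lemma square_root_near_one:
  assumes x: "x \<in> B" and r: "norm x \<le> r" "r < 1"
  obtains y where "y \<in> B" "norm y \<le> r" "(1 - y) \<circ>\<^sub>J (1 - y) = 1 - x"
proof -
  define f where "f y = (1/2) *\<^sub>R (x + y \<circ>\<^sub>J y)" for y
  have r0: "0 \<le> r" using r(1) norm_ge_zero[of x] by linarith
  have "\<exists>!y\<in>B \<inter> cball 0 r. f y = y"
  proof (rule Banach_fix)
    show "complete (B \<inter> cball 0 r)"
      by (intro complete_eq_closed[THEN iffD2] closed_Int closed closed_cball)
    show "B \<inter> cball 0 r \<noteq> {}" using B_zero r0 by force
    show "0 \<le> r" "r < 1" by fact+
    show "f ` (B \<inter> cball 0 r) \<subseteq> B \<inter> cball 0 r"
    proof safe
      fix y assume y: "y \<in> B" "y \<in> cball 0 r"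
      show "f y \<in> B" unfolding f_def by (intro B_scaleR B_add mult x y)
      have "norm (x + y \<circ>\<^sub>J y) \<le> r + r * r"
        using y r0 by (intro norm_triangle_le add_mono r order_trans[OF norm_jordan_le] mult_mono) auto
      also have "\<dots> \<le> r + r * 1" using r r0 by (intro add_mono mult_mono) auto
      finally show "f y \<in> cball 0 r" by (simp add: f_def)
    qed
    fix y z assume y: "y \<in> B \<inter> cball 0 r" and z: "z \<in> B \<inter> cball 0 r"
    have "f y - f z = (1/2) *\<^sub>R ((y + z) \<circ>\<^sub>J (y - z))"
      unfolding f_def by (simp add: jordan_bilinear jordan_commute[of z y] scaleR_diff_right[symmetric])
    then have "dist (f y) (f z) \<le> (1/2) * (norm (y + z) * norm (y - z))"
      by (simp add: dist_norm norm_jordan_le)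
    also have "\<dots> \<le> (1/2) * ((r + r) * norm (y - z))"
      using y z by (intro mult_left_mono mult_right_mono norm_triangle_le add_mono) auto
    finally show "dist (f y) (f z) \<le> r * dist y z" by (simp add: dist_norm)
  qed
  then obtain y where y: "y \<in> B" "norm y \<le> r" "f y = y" by auto
  have "x + y \<circ>\<^sub>J y = 2 *\<^sub>R f y" by (simp add: f_def)
  then have "x + y \<circ>\<^sub>J y = 2 *\<^sub>R y" using y(3) by simp
  then have "(1 - y) \<circ>\<^sub>J (1 - y) = 1 - x"
    by (simp add: jordan_bilinear scaleR_2 algebra_simps)
  with y that show ?thesis by blast
qed

definition is_square :: "'a \<Rightarrow> bool" where
  "is_square x \<longleftrightarrow> (\<exists>y\<in>B. x = y \<circ>\<^sub>J y)"

lemma is_square_mult: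
  assumes "is_square x" "is_square y"
  shows "is_square (x \<circ>\<^sub>J y)"
proof -
  obtain a b where ab: "a \<in> B" "x = a \<circ>\<^sub>J a" "b \<in> B" "y = b \<circ>\<^sub>J b"
    using assms unfolding is_square_def by blast
  have "(a \<circ>\<^sub>J a) \<circ>\<^sub>J (b \<circ>\<^sub>J b) = a \<circ>\<^sub>J (b \<circ>\<^sub>J (a \<circ>\<^sub>J b))"
    by (simp add: mult_assoc ab mult operator_commute[OF ab(3,1)])
  also have "\<dots> = (a \<circ>\<^sub>J b) \<circ>\<^sub>J (a \<circ>\<^sub>J b)" by (simp add: mult_assoc ab mult)
  finally show ?thesis unfolding is_square_def using ab mult by blast
qed

lemma is_square_scaleR:
  assumes "is_square x" "0 \<le> c"
  shows "is_square (c *\<^sub>R x)"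
proof -
  obtain a where a: "a \<in> B" "x = a \<circ>\<^sub>J a" using assms unfolding is_square_def by blast
  have "c *\<^sub>R x = (sqrt c *\<^sub>R a) \<circ>\<^sub>J (sqrt c *\<^sub>R a)" using assms a by (simp add: jordan_bilinear)
  then show ?thesis unfolding is_square_def using a B_scaleR by blast
qed

lemma is_square_one: "is_square 1"
  unfolding is_square_def using one by (intro bexI[of _ 1]) auto

lemma is_square_shift:
  assumes x: "x \<in> B" and "norm x < N"
  shows "is_square (N *\<^sub>R 1 - x)"
proof -
  have N: "N > 0" using assms norm_ge_zero[of x] by linarith
  then have "norm ((1/N) *\<^sub>R x) < 1" using assms by simp
  then obtain y where "y \<in> B" "(1 - y) \<circ>\<^sub>J (1 - y) = 1 - (1/N) *\<^sub>R x"
    using square_root_near_one[of "(1/N) *\<^sub>R x"] B_scaleR[OF x] by blast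
  then have "is_square (1 - (1/N) *\<^sub>R x)"
    unfolding is_square_def using B_diff[OF one] by metis
  then have "is_square (N *\<^sub>R (1 - (1/N) *\<^sub>R x))" using N by (intro is_square_scaleR) auto
  then show ?thesis using N by (simp add: scaleR_diff_right)
qed

text \<open>The difference is a square by \<open>is_square_shift\<close>, and adding
  \<open>x \<circ>\<^sub>J x\<close>, which cannot lower its norm, gives \<open>M\<^sup>2\<close>
  times the unit.\<close>

lemma norm_diff_square_le:
  assumes x: "x \<in> B" and "norm x < M"
  shows "norm (M\<^sup>2 *\<^sub>R 1 - x \<circ>\<^sub>J x) \<le> M\<^sup>2"
proof -
  have "norm (x \<circ>\<^sub>J x) < M\<^sup>2"
    using assms by (simp add: norm_square power_strict_mono)
  then obtain c where c: "c \<in> B" "M\<^sup>2 *\<^sub>R 1 - x \<circ>\<^sub>J x = c \<circ>\<^sub>J c"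
    using is_square_shift[OF mult[OF x x]] unfolding is_square_def by blast
  have "norm (c \<circ>\<^sub>J c) \<le> norm (c \<circ>\<^sub>J c + x \<circ>\<^sub>J x)"
    using norm_square_le[OF c(1) x] c(1) by (simp add: norm_square)
  also have "c \<circ>\<^sub>J c + x \<circ>\<^sub>J x = M\<^sup>2 *\<^sub>R 1" using c(2) by (simp add: algebra_simps)
  also have "norm (M\<^sup>2 *\<^sub>R (1::'a)) \<le> M\<^sup>2"
    using norm_one_le[where 'a = 'a] by (simp add: mult_left_le)
  finally show ?thesis using c by simp
qed

text \<open>Written as \<open>(M\<^sup>2 + b\<^sup>2) *\<^sub>R 1 - (M\<^sup>2 *\<^sub>R 1 - x
  \<circ>\<^sub>J x)\<close>, this is a shift by more than the norm of the bracket;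
  \<open>b \<noteq> 0\<close> provides the strictness.\<close>

lemma is_square_quadratic:
  assumes x: "x \<in> B" and b: "b \<noteq> 0"
  shows "is_square (x \<circ>\<^sub>J x + b\<^sup>2 *\<^sub>R 1)"
proof -
  define M where "M = norm x + 1"
  have "norm (M\<^sup>2 *\<^sub>R 1 - x \<circ>\<^sub>J x) \<le> M\<^sup>2" by (rule norm_diff_square_le[OF x]) (simp add: M_def)
  also have "\<dots> < M\<^sup>2 + b\<^sup>2" using b by simp
  finally have "is_square ((M\<^sup>2 + b\<^sup>2) *\<^sub>R 1 - (M\<^sup>2 *\<^sub>R 1 - x \<circ>\<^sub>J x))"
    by (intro is_square_shift B_diff B_scaleR one mult x)
  then show ?thesis by (simp add: scaleR_add_left algebra_simps)
qed

text \<open>The way back from squares to norms: completing \<open>x \<circ>\<^sub>J x\<close> by a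
  square to \<open>M\<^sup>2\<close> times the unit bounds its norm.\<close>

lemma norm_le_if_diff_square:
  assumes x: "x \<in> B" and "0 \<le> M" and "is_square (M\<^sup>2 *\<^sub>R 1 - x \<circ>\<^sub>J x)"
  shows "norm x \<le> M"
proof -
  obtain y where y: "y \<in> B" "M\<^sup>2 *\<^sub>R 1 - x \<circ>\<^sub>J x = y \<circ>\<^sub>J y"
    using assms unfolding is_square_def by blast
  have "(norm x)\<^sup>2 \<le> norm (x \<circ>\<^sub>J x + y \<circ>\<^sub>J y)" by (rule norm_square_le[OF x y(1)])
  also have "x \<circ>\<^sub>J x + y \<circ>\<^sub>J y = M\<^sup>2 *\<^sub>R 1" using y(2) by (simp add: algebra_simps)
  also have "norm (M\<^sup>2 *\<^sub>R (1::'a)) \<le> M\<^sup>2"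
    using norm_one_le[where 'a = 'a] by (simp add: mult_left_le)
  finally show ?thesis using \<open>0 \<le> M\<close> by (rule power2_le_imp_le)
qed

text \<open>Both \<open>m *\<^sub>R 1 - x\<close> and \<open>m *\<^sub>R 1 + x\<close> are squares,
  hence so is their product. This recovers the norm of \<open>x\<close> from first-order behaviour
  at the unit.\<close>

lemma norm_le_if_affine_bounds:
  assumes x: "x \<in> B" and t: "t > 0" and m: "0 \<le> m"
    and "norm (1 + t *\<^sub>R x) < 1 + t * m" "norm (1 - t *\<^sub>R x) < 1 + t * m"
  shows "norm x \<le> m"
proof (rule norm_le_if_diff_square[OF x m])
  have "is_square ((1 + t * m) *\<^sub>R 1 - (1 + t *\<^sub>R x))" "is_square ((1 + t * m) *\<^sub>R 1 - (1 - t *\<^sub>R x))"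
    using assms by (auto intro!: is_square_shift B_add B_diff B_scaleR one)
  then have "is_square ((1/t) *\<^sub>R ((1 + t * m) *\<^sub>R 1 - (1 + t *\<^sub>R x)))"
      "is_square ((1/t) *\<^sub>R ((1 + t * m) *\<^sub>R 1 - (1 - t *\<^sub>R x)))"
    using t by (auto intro!: is_square_scaleR)
  moreover have "(1/t) *\<^sub>R ((1 + t * m) *\<^sub>R 1 - (1 + t *\<^sub>R x)) = m *\<^sub>R 1 - x"
      "(1/t) *\<^sub>R ((1 + t * m) *\<^sub>R 1 - (1 - t *\<^sub>R x)) = m *\<^sub>R 1 + x"
    using t by (simp_all add: algebra_simps)
  ultimately have "is_square ((m *\<^sub>R 1 - x) \<circ>\<^sub>J (m *\<^sub>R 1 + x))" by (simp add: is_square_mult)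
  then show "is_square (m\<^sup>2 *\<^sub>R 1 - x \<circ>\<^sub>J x)"
    by (simp add: jordan_bilinear power2_eq_square algebra_simps)
qed

text \<open>For each \<open>e > 0\<close> the element
  \<open>e *\<^sub>R 1 - x \<circ>\<^sub>J x\<close> is a square, so \<open>norm x\<close> is at
  most \<open>sqrt e\<close>.\<close>

lemma zero_if_norm_one_plus_square_le:
  assumes x: "x \<in> B" and le: "norm (1 + x \<circ>\<^sub>J x) \<le> 1"
  shows "x = 0"
proof -
  have "(norm x)\<^sup>2 \<le> e" if "e > 0" for e
  proof -
    have "is_square ((1 + e) *\<^sub>R 1 - (1 + x \<circ>\<^sub>J x))"
      using le that by (intro is_square_shift B_add one mult x) auto
    then have "is_square ((sqrt e)\<^sup>2 *\<^sub>R 1 - x \<circ>\<^sub>J x)"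
      using that by (simp add: scaleR_add_left algebra_simps)
    then have "norm x \<le> sqrt e" using that by (intro norm_le_if_diff_square x) auto
    then have "(norm x)\<^sup>2 \<le> (sqrt e)\<^sup>2" by (intro power_mono) auto
    then show ?thesis using that by simp
  qed
  then have "(norm x)\<^sup>2 \<le> 0" by (rule field_le_epsilon[where y = 0, simplified]) 
  then show ?thesis by simp
qed

end

section \<open>Real polynomials positive on [-1,1] and their values at a contraction\<close>

lemma real_poly_complex_add:
  "poly (map_poly complex_of_real (p + q)) z =
    poly (map_poly complex_of_real p) z + poly (map_poly complex_of_real q) z"
  by (induction p q rule: poly_induct2) (simp_all add: map_poly_pCons algebra_simps)

lemma real_poly_complex_smult:
  "poly (map_poly complex_of_real (smult a p)) z = complex_of_real a * poly (map_poly complex_of_real p) z"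
  by (induction p) (simp_all add: map_poly_pCons algebra_simps)

lemma real_poly_complex_mult:
  "poly (map_poly complex_of_real (p * q)) z =
    poly (map_poly complex_of_real p) z * poly (map_poly complex_of_real q) z"
  by (induction p)
    (simp_all add: map_poly_pCons real_poly_complex_add real_poly_complex_smult algebra_simps)

lemma real_poly_complex_of_real:
  "poly (map_poly complex_of_real p) (complex_of_real x) = complex_of_real (poly p x)"
  by (induction p) (simp_all add: map_poly_pCons)

text \<open>The remainder modulo the quadratic is a real polynomial \<open>a + b X\<close> vanishing
  at the non-real point \<open>z\<close>, which forces \<open>b = 0\<close> and then
  \<open>a = 0\<close>.\<close>

lemma quadratic_dvd_if_root:
  fixes p :: "real poly"
  assumes root: "poly (map_poly complex_of_real p) z = 0" and im: "Im z \<noteq> 0"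
  shows "[:(Re z)\<^sup>2 + (Im z)\<^sup>2, - 2 * Re z, 1:] dvd p"
proof -
  define d where "d = [:(Re z)\<^sup>2 + (Im z)\<^sup>2, - 2 * Re z, 1:]"
  define r where "r = p mod d"
  have d0: "poly (map_poly complex_of_real d) z = 0"
    by (simp add: d_def map_poly_pCons complex_eq_iff power2_eq_square algebra_simps)
  have deg: "degree d = 2" by (simp add: d_def)
  then have dr: "r = 0 \<or> degree r < 2"
    using degree_mod_less[of d p] by (fastforce simp: r_def)
  have "p = d * (p div d) + r" by (simp add: r_def)
  then have "poly (map_poly complex_of_real r) z = 0"
    using root d0 by (metis real_poly_complex_add real_poly_complex_mult mult_zero_left add_0)
  moreover obtain a b where r: "r = [:a, b:]"
    using dr by (metis One_nat_def degree_0 degree_pCons_eq_if less_2_cases pCons_0_0 pCons_cases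
        nat.distinct(1) nat.inject degree_eq_zeroE less_one Suc_1 zero_less_Suc)
  ultimately have "complex_of_real a + z * complex_of_real b = 0"
    by (simp add: map_poly_pCons)
  then have "b = 0" "a = 0" using im by (auto simp: complex_eq_iff)
  then show ?thesis using r by (simp add: d_def r_def mod_eq_0_iff_dvd)
qed

text \<open>Roots are split off one by one. A real root lies outside [-1,1], and its linear factor
  is given the sign that is positive on the interval, so that the cofactor stays positive; a
  non-real root contributes \<open>(X - a)\<^sup>2 + b\<^sup>2\<close>.\<close>

lemma positive_poly_induct [consumes 1, case_names const left right quadratic]:
  fixes q :: "real poly"
  assumes pos: "\<forall>s\<in>{-1..1}. poly q s > 0"
    and const: "\<And>c. c > 0 \<Longrightarrow> P [:c:]"
    and left: "\<And>c q. c > 1 \<Longrightarrow> P q \<Longrightarrow> P ([:c, 1:] * q)"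
    and right: "\<And>c q. c > 1 \<Longrightarrow> P q \<Longrightarrow> P ([:c, -1:] * q)"
    and quadratic: "\<And>a b q. b \<noteq> 0 \<Longrightarrow> P q \<Longrightarrow> P ([:a\<^sup>2 + b\<^sup>2, - 2 * a, 1:] * q)"
  shows "P q"
  using pos
proof (induction "degree q" arbitrary: q rule: less_induct)
  case (less q)
  show ?case
  proof (cases "degree q = 0")
    case True
    then obtain c where c: "q = [:c:]" by (auto elim: degree_eq_zeroE)
    then show ?thesis using bspec[OF less.prems, of 0] const by simp
  next
    case False
    have q0: "q \<noteq> 0" using False by auto
    have "degree (map_poly complex_of_real q) \<noteq> 0" using False by (simp add: degree_map_poly)
    then obtain z where z: "poly (map_poly complex_of_real q) z = 0"
      using fundamental_theorem_of_algebra[of "map_poly complex_of_real q"]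
      by (auto simp: constant_degree)
    show ?thesis
    proof (cases "Im z = 0")
      case True
      define x where "x = Re z"
      have "z = complex_of_real x" using True by (simp add: complex_eq_iff x_def)
      then have "poly q x = 0" using z by (simp add: real_poly_complex_of_real)
      then have x: "\<not> (x \<in> {-1..1})" and "[:- x, 1:] dvd q"
        using bspec[OF less.prems, of x] by (auto simp: poly_eq_0_iff_dvd)
      then obtain r where r: "q = [:- x, 1:] * r" by (elim dvdE)
      then have deg: "degree q = Suc (degree r)"
        using q0 by (subst r, subst degree_mult_eq) auto
      have pos: "(s - x) * poly r s > 0" if "s \<in> {-1..1}" for s
        using less.prems that by (fastforce simp: r algebra_simps)
      consider "x > 1" | "x < -1" using x by force
      then show ?thesis
      proof cases
        case 1
        have "P (- r)"
        proof (rule less.hyps)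
          show "\<forall>s\<in>{-1..1}. poly (- r) s > 0"
            using pos 1 by (auto simp: zero_less_mult_iff)
        qed (use deg in simp)
        then have "P ([:x, -1:] * (- r))" by (rule right[OF 1])
        moreover have "[:x, -1:] * (- r) = q" unfolding r by simp
        ultimately show ?thesis by simp
      next
        case 2
        have "P r"
        proof (rule less.hyps)
          show "\<forall>s\<in>{-1..1}. poly r s > 0"
            using pos 2 by (auto simp: zero_less_mult_iff)
        qed (use deg in simp)
        then show ?thesis unfolding r using left[of "- x" r] 2 by simp
      qed
    next
      case False
      obtain r where r: "q = [:(Re z)\<^sup>2 + (Im z)\<^sup>2, - 2 * Re z, 1:] * r"
        using quadratic_dvd_if_root[OF z False] by (elim dvdE)
      have deg: "degree q = 2 + degree r"
        using q0 by (subst r, subst degree_mult_eq) (use r in auto)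
      have "P r"
      proof (rule less.hyps)
        show "\<forall>s\<in>{-1..1}. poly r s > 0"
        proof
          fix s :: real assume "s \<in> {-1..1}"
          then have "((s - Re z)\<^sup>2 + (Im z)\<^sup>2) * poly r s > 0"
            using less.prems by (fastforce simp: r power2_eq_square algebra_simps)
          moreover have "(s - Re z)\<^sup>2 + (Im z)\<^sup>2 > 0" using False by (simp add: add_nonneg_pos)
          ultimately show "poly r s > 0" by (simp add: zero_less_mult_iff)
        qed
      qed (use deg in simp)
      then show ?thesis unfolding r by (rule quadratic[OF False])
    qed
  qed
qed

text \<open>Horner's scheme: only multiplications by \<open>h\<close> occur, so no bracketing of
  powers has to be chosen.\<close>

definition jordan_poly :: "'a::unital_jb_star_algebra \<Rightarrow> real poly \<Rightarrow> 'a" where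
  "jordan_poly h p = fold_coeffs (\<lambda>a y. a *\<^sub>R 1 + h \<circ>\<^sub>J y) p 0"

lemma jordan_poly_0 [simp]: "jordan_poly h 0 = 0"
  by (simp add: jordan_poly_def)

lemma jordan_poly_pCons [simp]: "jordan_poly h (pCons a p) = a *\<^sub>R 1 + h \<circ>\<^sub>J jordan_poly h p"
  by (cases "p = 0 \<and> a = 0") (auto simp: jordan_poly_def)

lemma jordan_poly_add: "jordan_poly h (p + q) = jordan_poly h p + jordan_poly h q"
  by (induction p q rule: poly_induct2) (simp_all add: jordan_bilinear algebra_simps)

lemma jordan_poly_smult: "jordan_poly h (smult c p) = c *\<^sub>R jordan_poly h p"
  by (induction p) (simp_all add: jordan_bilinear algebra_simps)

lemma jordan_poly_diff: "jordan_poly h (p - q) = jordan_poly h p - jordan_poly h q"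
  using jordan_poly_add[of h "p - q" q] by (simp add: algebra_simps)

context hermitian_algebra
begin

lemma jordan_poly_mem: "h \<in> B \<Longrightarrow> jordan_poly h p \<in> B"
  by (induction p) (auto intro: B_zero B_add B_scaleR one mult)

lemma jordan_poly_mult:
  assumes h: "h \<in> B"
  shows "jordan_poly h (p * q) = jordan_poly h p \<circ>\<^sub>J jordan_poly h q"
  by (induction p)
    (simp_all add: jordan_poly_add jordan_poly_smult jordan_bilinear mult_assoc
      jordan_poly_mem h)

text \<open>The linear factors \<open>c \<plusminus> h\<close> are squares because
  \<open>norm h \<le> 1 < c\<close>; the others are \<open>(h - a)\<^sup>2 + b\<^sup>2\<close>, the
  case of \<open>is_square_quadratic\<close>.\<close>

lemma is_square_jordan_poly:
  assumes h: "h \<in> B" "norm h \<le> 1" and pos: "\<forall>s\<in>{-1..1}. poly q s > 0"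
  shows "is_square (jordan_poly h q)"
  using pos
proof (induction q rule: positive_poly_induct)
  case (const c)
  then show ?case using is_square_scaleR[OF is_square_one, of c] by simp
next
  case (left c q)
  have "is_square (c *\<^sub>R 1 - (- 1) *\<^sub>R h)"
    using left h by (intro is_square_shift B_scaleR) auto
  then have "is_square (jordan_poly h [:c, 1:])" by simp
  from is_square_mult[OF this left.IH] show ?case unfolding jordan_poly_mult[OF h(1)] .
next
  case (right c q)
  have "is_square (c *\<^sub>R 1 - h)"
    using right h by (intro is_square_shift) auto
  then have "is_square (jordan_poly h [:c, -1:])" by (simp add: jordan_bilinear)
  from is_square_mult[OF this right.IH] show ?case unfolding jordan_poly_mult[OF h(1)] .
next
  case (quadratic a b q)
  have "is_square ((h - a *\<^sub>R 1) \<circ>\<^sub>J (h - a *\<^sub>R 1) + b\<^sup>2 *\<^sub>R 1)"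
    using quadratic by (intro is_square_quadratic B_diff B_scaleR one h) auto
  also have "(h - a *\<^sub>R 1) \<circ>\<^sub>J (h - a *\<^sub>R 1) + b\<^sup>2 *\<^sub>R 1 = jordan_poly h [:a\<^sup>2 + b\<^sup>2, - 2 * a, 1:]"
    by (simp add: jordan_bilinear power2_eq_square algebra_simps flip: scaleR_2)
  finally have "is_square (jordan_poly h [:a\<^sup>2 + b\<^sup>2, - 2 * a, 1:])" .
  from is_square_mult[OF this quadratic.IH] show ?case unfolding jordan_poly_mult[OF h(1)] .
qed

text \<open>A spectral bound without a spectrum. The slack \<open>e\<close> makes
  \<open>(M + e)\<^sup>2 - p\<^sup>2\<close> strictly positive on [-1,1], as the factorization
  requires.\<close>

lemma norm_jordan_poly_le:
  assumes h: "h \<in> B" "norm h \<le> 1" and le: "\<And>s. s \<in> {-1..1} \<Longrightarrow> \<bar>poly p s\<bar> \<le> M"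
  shows "norm (jordan_poly h p) \<le> M"
proof (rule field_le_epsilon)
  fix e :: real assume e: "e > 0"
  have M: "0 \<le> M" using le[of 0] by simp
  have "is_square (jordan_poly h ([:(M + e)\<^sup>2:] - p * p))"
  proof (rule is_square_jordan_poly[OF h], rule ballI)
    fix s :: real assume "s \<in> {-1..1}"
    then have "\<bar>poly p s\<bar> < M + e" using le[of s] e by simp
    then have "\<bar>poly p s\<bar>\<^sup>2 < (M + e)\<^sup>2" by (intro power_strict_mono) auto
    then show "0 < poly ([:(M + e)\<^sup>2:] - p * p) s" by (simp add: power2_eq_square)
  qed
  then have "is_square ((M + e)\<^sup>2 *\<^sub>R 1 - jordan_poly h p \<circ>\<^sub>J jordan_poly h p)"
    by (simp add: jordan_poly_diff jordan_poly_mult h)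
  then show "norm (jordan_poly h p) \<le> M + e"
    using M e by (intro norm_le_if_diff_square jordan_poly_mem h) auto
qed

end

section \<open>Extremality of the unit\<close>

definition real_part :: "'a::complex_jordan_star_algebra \<Rightarrow> 'a" where
  "real_part x = (1/2) *\<^sub>R (x + star x)"

definition imaginary_part :: "'a::complex_jordan_star_algebra \<Rightarrow> 'a" where
  "imaginary_part x = (- \<i> / 2) *\<^sub>C (x - star x)"

lemma star_real_part [simp]: "star (real_part x) = real_part x"
  by (simp add: real_part_def star_scaleR star_add star_star add.commute)

lemma star_imaginary_part [simp]: "star (imaginary_part x) = imaginary_part x"
proof -
  have "star (imaginary_part x) = (\<i> / 2) *\<^sub>C (- (x - star x))"
    by (simp add: imaginary_part_def star_scaleC star_diff star_star)
  also have "\<dots> = (- (\<i> / 2)) *\<^sub>C (x - star x)"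
    by (simp only: scaleC_minus_left scaleC_minus_right)
  finally show ?thesis by (simp add: imaginary_part_def)
qed

lemma real_plus_imaginary_part: "real_part x + \<i> *\<^sub>C imaginary_part x = x"
proof -
  have "\<i> *\<^sub>C imaginary_part x = complex_of_real (1/2) *\<^sub>C (x - star x)"
    by (simp add: imaginary_part_def scaleC_scaleC)
  also have "\<dots> = (1/2) *\<^sub>R (x - star x)" by (rule scaleC_of_real)
  finally have "real_part x + \<i> *\<^sub>C imaginary_part x = (1/2) *\<^sub>R ((x + star x) + (x - star x))"
    by (simp only: real_part_def scaleR_add_right)
  also have "(x + star x) + (x - star x) = 2 *\<^sub>R x" by (simp add: scaleR_2)
  finally show ?thesis by simp
qed

text \<open>The element \<open>v = c - \<i>tk\<close> with \<open>c = (1 - t\<^sup>2k\<^sup>2)\<^sup>1\<^sup>/\<^sup>2\<close> is a contraction, and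
  \<open>v \<circ> (1 + tx) = 1 + th + O(t\<^sup>2)\<close>.\<close>

lemma norm_one_plus_hermitian_le:
  fixes h k :: "'a::unital_jb_star_algebra"
  defines "x \<equiv> h + \<i> *\<^sub>C k"
  assumes k: "star k = k" and t: "0 < t" "t \<le> 1" "t * norm k < 1"
  shows "norm (1 + t *\<^sub>R h) \<le>
    1 + t * norm x + t\<^sup>2 * ((norm k)\<^sup>2 + (norm k)\<^sup>2 * norm x + norm k * norm x)"
proof -
  interpret hermitian_algebra "generated k" by (rule generated_hermitian_algebra[OF k])
  define M m where "M = norm k" and "m = norm x"
  define d where "d = t *\<^sub>R k"
  have d: "d \<in> generated k" unfolding d_def by (intro B_scaleR generator_in_generated)
  have "norm (d \<circ>\<^sub>J d) \<le> (t * M)\<^sup>2" unfolding norm_square[OF d] using t by (simp add: d_def M_def)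
  moreover have "(t * M)\<^sup>2 < 1"
    using t power_strict_mono[of "t * M" 1 2] by (simp add: M_def)
  ultimately obtain y where y: "y \<in> generated k" "norm y \<le> (t * M)\<^sup>2"
      "(1 - y) \<circ>\<^sub>J (1 - y) = 1 - d \<circ>\<^sub>J d"
    using square_root_near_one[OF mult[OF d d]] by blast
  define v where "v = (1 - y) + \<i> *\<^sub>C (- d)"
  have md: "- d \<in> generated k" using B_diff[OF B_zero d] by simp
  have "(norm v)\<^sup>2 \<le> norm (1 :: 'a)"
    using norm_unit_decomposition[OF B_diff[OF one y(1)] md, folded v_def]
    unfolding y(3) by (simp add: jordan_minus_left jordan_minus_right)
  also have "\<dots> \<le> 1\<^sup>2" using norm_one_le by simp
  finally have v: "norm v \<le> 1" by (rule power2_le_imp_le) simp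
  \<comment> \<open>The term \<open>- \<i> d\<close> of \<open>v\<close> cancels the
    \<open>\<i> t k\<close> in \<open>t x\<close>, as \<open>d = t k\<close>. What is left over
    carries a factor \<open>y\<close> or \<open>t d\<close> and is
    \<open>O(t\<^sup>2)\<close>.\<close>
  have "1 + t *\<^sub>R h = v \<circ>\<^sub>J (1 + t *\<^sub>R x) + (y + t *\<^sub>R (y \<circ>\<^sub>J x)) + \<i> *\<^sub>C t *\<^sub>R (d \<circ>\<^sub>J x)"
    by (simp add: v_def x_def d_def jordan_bilinear scaleC_add_right scaleC_diff_right
        scaleC_minus_right scaleC_scaleR algebra_simps)
  then have "norm (1 + t *\<^sub>R h) \<le>
      norm (v \<circ>\<^sub>J (1 + t *\<^sub>R x)) + (norm y + norm (t *\<^sub>R (y \<circ>\<^sub>J x))) + norm (\<i> *\<^sub>C t *\<^sub>R (d \<circ>\<^sub>J x))"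
    by (metis (no_types, lifting) norm_triangle_le add_mono norm_triangle_ineq order_refl)
  also have "norm (v \<circ>\<^sub>J (1 + t *\<^sub>R x)) \<le> 1 * (1 + t * m)"
    using t norm_one_le[where 'a = 'a]
    by (intro order_trans[OF norm_jordan_le] mult_mono v norm_triangle_le add_mono) (auto simp: m_def)
  also have "norm (t *\<^sub>R (y \<circ>\<^sub>J x)) \<le> 1 * ((t * M)\<^sup>2 * m)"
    unfolding norm_scaleR m_def using t y
    by (intro mult_mono order_trans[OF norm_jordan_le]) auto
  also have "norm (\<i> *\<^sub>C t *\<^sub>R (d \<circ>\<^sub>J x)) \<le> t * ((t * M) * m)"
    unfolding norm_scaleC norm_scaleR m_def using t
    by (auto simp: d_def M_def intro!: mult_left_mono order_trans[OF norm_jordan_le])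
  finally show ?thesis
    using y(2) by (simp add: M_def m_def power2_eq_square algebra_simps)
qed

text \<open>The estimate near the unit holds for \<open>h\<close> and for \<open>- h\<close>; for
  small \<open>t\<close> its quadratic term is absorbed by \<open>t * e\<close>. Averaging
  \<open>x\<close> with \<open>star x\<close> would not do, since the norm of \<open>star x\<close>
  is only known up to a factor 3.\<close>

lemma norm_real_part_le:
  fixes h k :: "'a::unital_jb_star_algebra"
  assumes h: "star h = h" and k: "star k = k"
  shows "norm h \<le> norm (h + \<i> *\<^sub>C k)"
proof (rule field_le_epsilon)
  fix e :: real assume e: "e > 0"
  interpret hermitian_algebra "generated h" by (rule generated_hermitian_algebra[OF h])
  define M m where "M = norm k" and "m = norm (h + \<i> *\<^sub>C k)"
  define K where "K = M\<^sup>2 + M\<^sup>2 * m + M * m"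
  \<comment> \<open>\<open>1 / (M + 2)\<close> secures \<open>t * M < 1\<close>, and
    \<open>e / (K + 1)\<close> secures \<open>t * K < e\<close>.\<close>
  define t where "t = min 1 (min (1 / (M + 2)) (e / (K + 1)))"
  have M: "0 \<le> M" and m: "0 \<le> m" by (simp_all add: M_def m_def)
  then have K: "0 \<le> K" by (simp add: K_def)
  have t: "0 < t" "t \<le> 1" "t \<le> 1 / (M + 2)" "t \<le> e / (K + 1)"
    using M K e by (auto simp: t_def)
  have "M + 2 > 0" "K + 1 > 0" using M K by simp_all
  then have "t * (M + 2) \<le> 1" "t * (K + 1) \<le> e"
    using t(3,4) by (simp_all only: pos_le_divide_eq)
  then have tM: "t * M < 1" and tK: "t * K < e" using t by (simp_all add: algebra_simps)
  have mm: "norm (- h + \<i> *\<^sub>C (- k)) = m"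
    by (metis m_def scaleC_minus_right minus_add_distrib norm_minus_cancel)
  have bound: "1 + t * m + t\<^sup>2 * K < 1 + t * (m + e)"
    using tK t by (simp add: power2_eq_square algebra_simps)
  have "norm (1 + t *\<^sub>R h) \<le> 1 + t * m + t\<^sup>2 * K"
    using norm_one_plus_hermitian_le[OF k t(1,2), of h] tM by (simp add: M_def m_def K_def)
  moreover have "norm (1 + t *\<^sub>R (- h)) \<le> 1 + t * m + t\<^sup>2 * K"
    using norm_one_plus_hermitian_le[of "- k" t "- h"] tM t k mm by (simp add: M_def K_def star_minus)
  ultimately show "norm h \<le> norm (h + \<i> *\<^sub>C k) + e"
    using bound t m e unfolding m_def[symmetric]
    by (intro norm_le_if_affine_bounds[OF generator_in_generated, of t]) auto
qed

lemma norm_real_part: "norm (real_part x) \<le> norm (x :: 'a::unital_jb_star_algebra)"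
  using norm_real_part_le[of "real_part x" "imaginary_part x"] by (simp add: real_plus_imaginary_part)

text \<open>Multiplication by \<open>- \<i>\<close> turns the imaginary part into the real part and
  keeps the norm.\<close>

lemma norm_imaginary_part: "norm (imaginary_part x) \<le> norm (x :: 'a::unital_jb_star_algebra)"
proof -
  have "imaginary_part x + \<i> *\<^sub>C (- real_part x) = (- \<i>) *\<^sub>C (real_part x + \<i> *\<^sub>C imaginary_part x)"
    by (simp only: scaleC_add_right scaleC_minus_left scaleC_minus_right ii_scaleC_ii) simp
  also have "\<dots> = (- \<i>) *\<^sub>C x" by (simp only: real_plus_imaginary_part)
  finally have "norm (imaginary_part x + \<i> *\<^sub>C (- real_part x)) = norm x" by (simp add: norm_scaleC)
  then show ?thesis using norm_real_part_le[of "imaginary_part x" "- real_part x"]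
    by (simp add: star_minus)
qed

lemma hermitian_zero_if_norm_one_plus_square_le:
  fixes h :: "'a::unital_jb_star_algebra"
  assumes "star h = h" "norm (1 + h \<circ>\<^sub>J h) \<le> 1"
  shows "h = 0"
  using hermitian_algebra.zero_if_norm_one_plus_square_le[OF generated_hermitian_algebra[OF assms(1)]
    generator_in_generated assms(2)] .

text \<open>The real part \<open>a\<close> goes first: averaging the squares of \<open>1 + a\<close>
  and \<open>1 - a\<close> bounds \<open>1 + a \<circ>\<^sub>J a\<close>. Once \<open>a = 0\<close>,
  the product of \<open>1 + y\<close> and \<open>1 - y\<close> is
  \<open>1 + b \<circ>\<^sub>J b\<close>, which forces \<open>b = 0\<close>.\<close>

lemma one_extreme:
  fixes y :: "'a::unital_jb_star_algebra"
  assumes le: "norm (1 + y) \<le> 1" "norm (1 - y) \<le> 1"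
  shows "y = 0"
proof -
  define a b where "a = real_part y" and "b = imaginary_part y"
  have y: "y = a + \<i> *\<^sub>C b" by (simp add: a_def b_def real_plus_imaginary_part)
  have ab: "star a = a" "star b = b" by (simp_all add: a_def b_def)
  have "norm (1 + a) \<le> 1"
    using norm_real_part_le[of "1 + a" b] ab le(1) by (simp add: y star_add add.assoc)
  moreover have "norm (1 - a) \<le> 1"
    using norm_real_part_le[of "1 - a" "- b"] ab le(2)
    by (simp add: y star_diff star_minus scaleC_minus_right algebra_simps)
  ultimately have "norm ((1 + a) \<circ>\<^sub>J (1 + a)) \<le> 1" "norm ((1 - a) \<circ>\<^sub>J (1 - a)) \<le> 1"
    by (auto intro!: order_trans[OF norm_jordan_le] mult_le_one)
  then have "norm ((1 + a) \<circ>\<^sub>J (1 + a) + (1 - a) \<circ>\<^sub>J (1 - a)) \<le> 2" by norm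
  also have "(1 + a) \<circ>\<^sub>J (1 + a) + (1 - a) \<circ>\<^sub>J (1 - a) = 2 *\<^sub>R (1 + a \<circ>\<^sub>J a)"
    by (simp add: jordan_bilinear scaleR_2)
  finally have "norm (1 + a \<circ>\<^sub>J a) \<le> 1" by simp
  then have a: "a = 0" using hermitian_zero_if_norm_one_plus_square_le ab by blast
  have "(1 + y) \<circ>\<^sub>J (1 - y) = 1 + b \<circ>\<^sub>J b"
    by (simp add: y a jordan_bilinear scaleC_add_right ii_scaleC_ii)
  moreover have "norm ((1 + y) \<circ>\<^sub>J (1 - y)) \<le> 1 * 1"
    using le by (intro order_trans[OF norm_jordan_le] mult_mono) auto
  ultimately have "b = 0" using hermitian_zero_if_norm_one_plus_square_le ab by simp
  then show ?thesis by (simp add: y a)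
qed

text \<open>For the unitaries \<open>u = e\<^sup>i\<^sup>h\<close> used below, \<open>w = e\<^sup>-\<^sup>i\<^sup>h\<^sup>/\<^sup>n\<close> transports extremality of \<open>1\<close> to
  \<open>u\<close>: multiplication by \<open>w\<close> is contractive, and injective because \<open>w\<close> is close to \<open>1\<close>.\<close>

definition has_small_logarithm :: "'a::unital_jb_star_algebra \<Rightarrow> bool" where
  "has_small_logarithm u \<longleftrightarrow> (\<exists>w n. norm w \<le> 1 \<and> norm (1 - w) < 1 \<and> ((\<circ>\<^sub>J) w ^^ n) u = 1)"

lemma has_small_logarithm_extreme:
  fixes u y :: "'a::unital_jb_star_algebra"
  assumes "has_small_logarithm u" and le: "norm (u + y) \<le> 1" "norm (u - y) \<le> 1"
  shows "y = 0"
proof -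
  obtain w n where w: "norm w \<le> 1" "norm (1 - w) < 1" and u: "((\<circ>\<^sub>J) w ^^ n) u = 1"
    using assms unfolding has_small_logarithm_def by blast
  let ?L = "(\<circ>\<^sub>J) w ^^ n"
  have contr: "norm (((\<circ>\<^sub>J) w ^^ k) z) \<le> norm z" for k z
  proof (induction k)
    case (Suc k)
    have "norm (w \<circ>\<^sub>J ((\<circ>\<^sub>J) w ^^ k) z) \<le> 1 * norm z"
      using w Suc by (intro order_trans[OF norm_jordan_le] mult_mono) auto
    then show ?case by simp
  qed simp
  have add: "((\<circ>\<^sub>J) w ^^ k) (a + b) = ((\<circ>\<^sub>J) w ^^ k) a + ((\<circ>\<^sub>J) w ^^ k) b"
    and diff: "((\<circ>\<^sub>J) w ^^ k) (a - b) = ((\<circ>\<^sub>J) w ^^ k) a - ((\<circ>\<^sub>J) w ^^ k) b" for k a b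
    by (induction k) (simp_all add: jordan_bilinear)
  have inj: "z = 0" if "((\<circ>\<^sub>J) w ^^ k) z = 0" for k z
    using that
  proof (induction k)
    case (Suc k)
    define v where "v = ((\<circ>\<^sub>J) w ^^ k) z"
    have "w \<circ>\<^sub>J v = 0" using Suc.prems by (simp add: v_def)
    then have "v = (1 - w) \<circ>\<^sub>J v" by (simp add: jordan_bilinear)
    then have "norm v \<le> norm (1 - w) * norm v" by (metis norm_jordan_le)
    then have "v = 0" using w(2)
      by (metis mult_le_cancel_right1 norm_le_zero_iff not_less)
    then show ?case using Suc.IH by (simp add: v_def)
  qed simp
  have "norm (1 + ?L y) \<le> 1" using contr[of n "u + y"] le u by (simp add: add)
  moreover have "norm (1 - ?L y) \<le> 1" using contr[of n "u - y"] le u by (simp add: diff)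
  ultimately show ?thesis using one_extreme inj by blast
qed

section \<open>Continuous functional calculus\<close>

locale hermitian_contraction =
  fixes h :: "'a::unital_jb_star_algebra"
  assumes star_h: "star h = h" and norm_h: "norm h \<le> 1"

sublocale hermitian_contraction \<subseteq> hermitian_algebra "generated h"
  by (rule generated_hermitian_algebra[OF star_h])

context hermitian_contraction
begin

text \<open>\<open>x\<close> is \<open>g(h)\<close>, with one sequence of polynomials witnessing
  both limits. As a relation it obeys the rules for sums and products before existence is
  known.\<close>

definition represents :: "'a \<Rightarrow> (real \<Rightarrow> real) \<Rightarrow> bool" where
  "represents x g \<longleftrightarrow> (\<exists>P. uniform_limit {-1..1} (\<lambda>n. poly (P n)) g sequentially \<and>
    (\<lambda>n. jordan_poly h (P n)) \<longlonglongrightarrow> x)"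

lemmas h_mem = generator_in_generated[of h]

lemma norm_poly_le:
  "(\<And>s. s \<in> {-1..1} \<Longrightarrow> \<bar>poly p s\<bar> \<le> M) \<Longrightarrow> norm (jordan_poly h p) \<le> M"
  by (rule norm_jordan_poly_le[OF h_mem norm_h])

lemma represents_mem: "represents x g \<Longrightarrow> x \<in> generated h"
  unfolding represents_def by (auto intro: closed_sequentially[OF closed] jordan_poly_mem[OF h_mem])

lemma represents_norm_le:
  assumes x: "represents x g" and le: "\<And>s. s \<in> {-1..1} \<Longrightarrow> \<bar>g s\<bar> \<le> M"
  shows "norm x \<le> M"
proof (rule field_le_epsilon)
  fix e :: real assume e: "e > 0"
  obtain P where P: "uniform_limit {-1..1} (\<lambda>n. poly (P n)) g sequentially"
      and lim: "(\<lambda>n. jordan_poly h (P n)) \<longlonglongrightarrow> x"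
    using x unfolding represents_def by blast
  have "\<forall>\<^sub>F n in sequentially. \<forall>s\<in>{-1..1}. dist (poly (P n) s) (g s) < e"
    using P e unfolding uniform_limit_iff by blast
  then have "\<forall>\<^sub>F n in sequentially. norm (jordan_poly h (P n)) \<le> M + e"
  proof (rule eventually_mono)
    fix n assume n: "\<forall>s\<in>{-1..1}. dist (poly (P n) s) (g s) < e"
    show "norm (jordan_poly h (P n)) \<le> M + e"
    proof (rule norm_poly_le)
      fix s :: real assume s: "s \<in> {-1..1}"
      show "\<bar>poly (P n) s\<bar> \<le> M + e" using bspec[OF n s] le[OF s] by (simp add: dist_real_def)
    qed
  qed
  then show "norm x \<le> M + e"
    by (intro tendsto_upperbound[OF tendsto_norm[OF lim]]) auto
qed

lemma represents_poly: "represents (jordan_poly h p) (poly p)"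
  unfolding represents_def
  by (intro exI[of _ "\<lambda>_. p"] conjI tendsto_const uniform_limit_const)

lemma represents_one: "represents 1 (\<lambda>_. 1)"
proof -
  have "poly [:1:] = (\<lambda>_. 1 :: real)" by (simp add: fun_eq_iff)
  then show ?thesis using represents_poly[of "[:1:]"] by simp
qed

lemma represents_id: "represents h (\<lambda>s. s)"
proof -
  have "poly [:0, 1:] = (\<lambda>s. s :: real)" by (simp add: fun_eq_iff)
  then show ?thesis using represents_poly[of "[:0, 1:]"] by simp
qed

lemma represents_add:
  assumes "represents x f" "represents y g"
  shows "represents (x + y) (\<lambda>s. f s + g s)"
proof -
  obtain P Q where P: "uniform_limit {-1..1} (\<lambda>n. poly (P n)) f sequentially"
      "(\<lambda>n. jordan_poly h (P n)) \<longlonglongrightarrow> x"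
    and Q: "uniform_limit {-1..1} (\<lambda>n. poly (Q n)) g sequentially"
      "(\<lambda>n. jordan_poly h (Q n)) \<longlonglongrightarrow> y"
    using assms unfolding represents_def by blast
  have eq: "(\<lambda>n. poly (P n + Q n)) = (\<lambda>n s. poly (P n) s + poly (Q n) s)" by (simp add: fun_eq_iff)
  show ?thesis
    unfolding represents_def
    using uniform_limit_add[OF P(1) Q(1)] tendsto_add[OF P(2) Q(2)]
    by (intro exI[of _ "\<lambda>n. P n + Q n"]) (simp only: eq jordan_poly_add)
qed

lemma represents_scaleR:
  assumes "represents x f"
  shows "represents (c *\<^sub>R x) (\<lambda>s. c * f s)"
proof -
  obtain P where P: "uniform_limit {-1..1} (\<lambda>n. poly (P n)) f sequentially"
      "(\<lambda>n. jordan_poly h (P n)) \<longlonglongrightarrow> x"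
    using assms unfolding represents_def by blast
  have eq: "(\<lambda>n. poly (smult c (P n))) = (\<lambda>n s. c * poly (P n) s)" by (simp add: fun_eq_iff)
  show ?thesis
    unfolding represents_def
    using bounded_linear.uniform_limit[OF bounded_linear_mult_right P(1), of c]
      tendsto_scaleR[OF tendsto_const P(2), of c]
    by (intro exI[of _ "\<lambda>n. smult c (P n)"]) (simp only: eq jordan_poly_smult)
qed

lemma represents_mult:
  assumes "represents x f" "represents y g"
    and "continuous_on {-1..1} f" "continuous_on {-1..1} g"
  shows "represents (x \<circ>\<^sub>J y) (\<lambda>s. f s * g s)"
proof -
  obtain P Q where P: "uniform_limit {-1..1} (\<lambda>n. poly (P n)) f sequentially"
      "(\<lambda>n. jordan_poly h (P n)) \<longlonglongrightarrow> x"
    and Q: "uniform_limit {-1..1} (\<lambda>n. poly (Q n)) g sequentially"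
      "(\<lambda>n. jordan_poly h (Q n)) \<longlonglongrightarrow> y"
    using assms unfolding represents_def by blast
  \<comment> \<open>Products of uniform limits converge uniformly because the limits are bounded;
    this is what continuity is assumed for.\<close>
  have "bounded (f ` {-1..1})" "bounded (g ` {-1..1})"
    using assms by (auto intro!: compact_imp_bounded compact_continuous_image)
  then have "uniform_limit {-1..1} (\<lambda>n s. poly (P n) s * poly (Q n) s) (\<lambda>s. f s * g s) sequentially"
    by (intro bounded_bilinear.bounded_uniform_limit[OF bounded_bilinear_mult] P Q)
  moreover have eq: "(\<lambda>n. poly (P n * Q n)) = (\<lambda>n s. poly (P n) s * poly (Q n) s)"
    by (simp add: fun_eq_iff)
  ultimately show ?thesis
    unfolding represents_def using jordan.tendsto[OF P(2) Q(2)]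
    by (intro exI[of _ "\<lambda>n. P n * Q n"]) (simp only: eq jordan_poly_mult[OF h_mem])
qed

lemma represents_unique:
  assumes "represents x f" "represents y g" "\<And>s. s \<in> {-1..1} \<Longrightarrow> f s = g s"
  shows "x = y"
proof -
  have "represents (x + (-1) *\<^sub>R y) (\<lambda>s. f s + (-1) * g s)"
    by (intro represents_add represents_scaleR assms)
  then have "norm (x + (-1) *\<^sub>R y) \<le> 0" by (rule represents_norm_le) (simp add: assms(3))
  then show ?thesis by simp
qed

text \<open>By the norm bound for polynomials, the uniform approximants from Stone-Weierstrass
  evaluate to a Cauchy sequence.\<close>

lemma represents_exists:
  assumes g: "continuous_on {-1..1} g"
  shows "\<exists>x. represents x g"
proof -
  have "\<exists>p. \<forall>s\<in>{-1..1}. \<bar>poly p s - g s\<bar> < inverse (real (Suc n))" for n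
  proof -
    obtain q where q: "real_polynomial_function q"
        "\<And>s. s \<in> {-1..1} \<Longrightarrow> \<bar>g s - q s\<bar> < inverse (real (Suc n))"
      using Stone_Weierstrass_real_polynomial_function[of "{-1..1}" g "inverse (real (Suc n))"] g
      by auto
    obtain a N where "q = (\<lambda>x. \<Sum>i\<le>N. a i * x ^ i)"
      using q(1) unfolding real_polynomial_function_iff_sum by blast
    then have "poly (\<Sum>i\<le>N. monom (a i) i) = q" by (simp add: poly_sum poly_monom fun_eq_iff)
    then show ?thesis using q(2) by (metis abs_minus_commute)
  qed
  then obtain P where P: "\<And>n s. s \<in> {-1..1} \<Longrightarrow> \<bar>poly (P n) s - g s\<bar> < inverse (real (Suc n))"
    by metis
  have "uniform_limit {-1..1} (\<lambda>n. poly (P n)) g sequentially"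
  proof (rule uniform_limitI)
    fix e :: real assume "e > 0"
    then have "\<forall>\<^sub>F n in sequentially. inverse (real (Suc n)) < e"
      using LIMSEQ_inverse_real_of_nat by (simp add: order_tendsto_iff)
    then show "\<forall>\<^sub>F n in sequentially. \<forall>s\<in>{-1..1}. dist (poly (P n) s) (g s) < e"
      by (rule eventually_mono) (use P in \<open>force simp: dist_real_def intro: less_trans\<close>)
  qed
  moreover have "Cauchy (\<lambda>n. jordan_poly h (P n))"
  proof (rule metric_CauchyI)
    fix e :: real assume "e > 0"
    then obtain N where N: "inverse (real (Suc N)) < e / 2"
      using reals_Archimedean[of "e / 2"] by auto
    have "dist (jordan_poly h (P m)) (jordan_poly h (P n)) < e" if "m \<ge> N" "n \<ge> N" for m n
    proof -
      have "norm (jordan_poly h (P m - P n)) \<le> 2 * inverse (real (Suc N))"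
      proof (rule norm_poly_le)
        fix s :: real assume s: "s \<in> {-1..1}"
        have "inverse (real (Suc m)) \<le> inverse (real (Suc N))"
            "inverse (real (Suc n)) \<le> inverse (real (Suc N))"
          using that by (auto intro!: le_imp_inverse_le)
        then show "\<bar>poly (P m - P n) s\<bar> \<le> 2 * inverse (real (Suc N))"
          using P[OF s, of m] P[OF s, of n] by (simp only: poly_diff)
      qed
      then show ?thesis using N by (simp add: jordan_poly_diff dist_norm)
    qed
    then show "\<exists>N. \<forall>m\<ge>N. \<forall>n\<ge>N. dist (jordan_poly h (P m)) (jordan_poly h (P n)) < e" by blast
  qed
  then obtain x where "(\<lambda>n. jordan_poly h (P n)) \<longlonglongrightarrow> x"
    using Cauchy_convergent_iff convergent_def by blast
  ultimately show ?thesis unfolding represents_def by blast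
qed

text \<open>Unique for \<open>g\<close> continuous on [-1,1]. Uniform limits of polynomials are
  continuous, so for any other \<open>g\<close> nothing is represented and the choice is
  arbitrary.\<close>

definition calc :: "(real \<Rightarrow> real) \<Rightarrow> 'a" where
  "calc g = (SOME x. represents x g)"

lemma calc: "continuous_on {-1..1} g \<Longrightarrow> represents (calc g) g"
  unfolding calc_def using represents_exists by (rule someI_ex)

lemma calc_mem: "continuous_on {-1..1} g \<Longrightarrow> calc g \<in> generated h"
  by (rule represents_mem[OF calc])

lemma calc_unique:
  assumes "represents x f" "continuous_on {-1..1} g" "\<And>s. s \<in> {-1..1} \<Longrightarrow> g s = f s"
  shows "calc g = x"
  by (rule represents_unique[OF calc[OF assms(2)] assms(1,3)])

lemma calc_add:
  assumes "continuous_on {-1..1} f" "continuous_on {-1..1} g"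
  shows "calc (\<lambda>s. f s + g s) = calc f + calc g"
  by (rule calc_unique[OF represents_add[OF calc calc]]) (use assms in \<open>auto intro!: continuous_intros\<close>)

lemma calc_scaleR:
  assumes "continuous_on {-1..1} f"
  shows "calc (\<lambda>s. c * f s) = c *\<^sub>R calc f"
  by (rule calc_unique[OF represents_scaleR[OF calc]]) (use assms in \<open>auto intro!: continuous_intros\<close>)

lemma calc_mult:
  assumes "continuous_on {-1..1} f" "continuous_on {-1..1} g"
  shows "calc (\<lambda>s. f s * g s) = calc f \<circ>\<^sub>J calc g"
  by (rule calc_unique[OF represents_mult[OF calc calc]]) (use assms in \<open>auto intro!: continuous_intros\<close>)

lemma calc_one: "calc (\<lambda>_. 1) = 1"
  by (rule calc_unique[OF represents_one]) auto

section \<open>The unitaries exp(\<i> g(h))\<close>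

definition calc_exp :: "(real \<Rightarrow> real) \<Rightarrow> 'a" where
  "calc_exp g = calc (\<lambda>s. cos (g s)) + \<i> *\<^sub>C calc (\<lambda>s. sin (g s))"

lemma calc_exp_add:
  assumes f: "continuous_on {-1..1} f" and g: "continuous_on {-1..1} g"
  shows "calc_exp (\<lambda>s. f s + g s) = calc_exp f \<circ>\<^sub>J calc_exp g"
proof -
  note cont = continuous_on_cos[OF f] continuous_on_sin[OF f] continuous_on_cos[OF g] continuous_on_sin[OF g]
  have "calc (\<lambda>s. cos (f s + g s)) =
      calc (\<lambda>s. cos (f s) * cos (g s) + (-1) * (sin (f s) * sin (g s)))"
    by (simp add: cos_add)
  also have "\<dots> = calc (\<lambda>s. cos (f s)) \<circ>\<^sub>J calc (\<lambda>s. cos (g s)) +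
      (-1) *\<^sub>R (calc (\<lambda>s. sin (f s)) \<circ>\<^sub>J calc (\<lambda>s. sin (g s)))"
    by (simp only: calc_add[OF continuous_on_mult[OF cont(1,3)]
          continuous_on_mult[OF continuous_on_const continuous_on_mult[OF cont(2,4)]]]
        calc_scaleR[OF continuous_on_mult[OF cont(2,4)]] calc_mult[OF cont(1,3)] calc_mult[OF cont(2,4)])
  finally have c: "calc (\<lambda>s. cos (f s + g s)) = calc (\<lambda>s. cos (f s)) \<circ>\<^sub>J calc (\<lambda>s. cos (g s)) +
      (-1) *\<^sub>R (calc (\<lambda>s. sin (f s)) \<circ>\<^sub>J calc (\<lambda>s. sin (g s)))" .
  have "calc (\<lambda>s. sin (f s + g s)) = calc (\<lambda>s. sin (f s) * cos (g s) + cos (f s) * sin (g s))"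
    by (simp add: sin_add)
  also have "\<dots> = calc (\<lambda>s. sin (f s)) \<circ>\<^sub>J calc (\<lambda>s. cos (g s)) +
      calc (\<lambda>s. cos (f s)) \<circ>\<^sub>J calc (\<lambda>s. sin (g s))"
    by (simp only: calc_add[OF continuous_on_mult[OF cont(2,3)] continuous_on_mult[OF cont(1,4)]]
        calc_mult[OF cont(2,3)] calc_mult[OF cont(1,4)])
  finally have s: "calc (\<lambda>s. sin (f s + g s)) = calc (\<lambda>s. sin (f s)) \<circ>\<^sub>J calc (\<lambda>s. cos (g s)) +
      calc (\<lambda>s. cos (f s)) \<circ>\<^sub>J calc (\<lambda>s. sin (g s))" .
  show ?thesis
    unfolding calc_exp_def c s
    by (simp add: jordan_bilinear scaleC_add_right ii_scaleC_ii)
qed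

lemma calc_exp_zero: "calc_exp (\<lambda>_. 0) = 1"
proof -
  have "calc (\<lambda>s. 0 * 1) = 0 *\<^sub>R calc (\<lambda>_. 1)" by (rule calc_scaleR) (rule continuous_on_const)
  then have "calc (\<lambda>_. 0) = 0" by simp
  then show ?thesis by (simp add: calc_exp_def calc_one)
qed

lemma star_calc_exp:
  assumes f: "continuous_on {-1..1} f"
  shows "star (calc_exp f) = calc_exp (\<lambda>s. - f s)"
proof -
  note cont = continuous_on_cos[OF f] continuous_on_sin[OF f]
  have "calc (\<lambda>s. sin (- f s)) = - calc (\<lambda>s. sin (f s))"
    using calc_scaleR[OF cont(2), of "-1"] by simp
  then show ?thesis
    using cont[THEN calc_mem, THEN hermitian]
    by (simp add: calc_exp_def star_add star_scaleC scaleC_minus_left scaleC_minus_right)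
qed

lemma norm_calc_exp:
  assumes f: "continuous_on {-1..1} f"
  shows "norm (calc_exp f) \<le> 1"
proof -
  note cont = continuous_on_cos[OF f] continuous_on_sin[OF f]
  have "calc (\<lambda>s. cos (f s)) \<circ>\<^sub>J calc (\<lambda>s. cos (f s)) + calc (\<lambda>s. sin (f s)) \<circ>\<^sub>J calc (\<lambda>s. sin (f s))
      = calc (\<lambda>s. cos (f s) * cos (f s) + sin (f s) * sin (f s))"
    by (simp only: calc_add[OF continuous_on_mult[OF cont(1,1)] continuous_on_mult[OF cont(2,2)]]
        calc_mult[OF cont(1,1)] calc_mult[OF cont(2,2)])
  also have "\<dots> = 1" by (simp add: calc_one flip: power2_eq_square)
  finally have "(norm (calc_exp f))\<^sup>2 \<le> norm (1 :: 'a)"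
    using norm_unit_decomposition[OF cont[THEN calc_mem]] by (simp add: calc_exp_def)
  also have "\<dots> \<le> 1\<^sup>2" using norm_one_le by simp
  finally show ?thesis by (rule power2_le_imp_le) simp
qed

lemma jordan_inverse_calc_exp:
  assumes f: "continuous_on {-1..1} f"
  shows "jordan_inverse (calc_exp f) (star (calc_exp f))"
proof -
  have "calc_exp f \<circ>\<^sub>J calc_exp (\<lambda>s. - f s) = 1"
    using calc_exp_add[OF f continuous_on_minus[OF f]] by (simp add: calc_exp_zero)
  moreover have "(calc_exp f \<circ>\<^sub>J calc_exp f) \<circ>\<^sub>J calc_exp (\<lambda>s. - f s) = calc_exp f"
    using calc_exp_add[OF continuous_on_add[OF f f] continuous_on_minus[OF f]] calc_exp_add[OF f f]
    by simp
  ultimately show ?thesis unfolding jordan_inverse_def by (simp add: star_calc_exp f)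
qed

text \<open>\<open>1 - cos r = 2 (sin (r / 2))\<^sup>2\<close> is at most 1/8 for
  \<open>\<bar>r\<bar> \<le> 1 / 2\<close>, and the sine part adds at most 1/2.\<close>

lemma norm_one_minus_calc_exp:
  assumes f: "continuous_on {-1..1} f" and le: "\<And>s. s \<in> {-1..1} \<Longrightarrow> \<bar>f s\<bar> \<le> 1 / 2"
  shows "norm (1 - calc_exp f) < 1"
proof -
  note cont = continuous_on_cos[OF f] continuous_on_sin[OF f]
  have rep: "represents (1 + (-1) *\<^sub>R calc (\<lambda>s. cos (f s))) (\<lambda>s. 1 + (-1) * cos (f s))"
    by (intro represents_one represents_add represents_scaleR calc cont)
  have "norm (1 + (-1) *\<^sub>R calc (\<lambda>s. cos (f s))) \<le> 1 / 8"
  proof (rule represents_norm_le[OF rep])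
    fix s :: real assume s: "s \<in> {-1..1}"
    have "1 + (-1) * cos (f s) = 2 * (sin (f s / 2))\<^sup>2"
      using cos_double_sin[of "f s / 2"] by simp
    moreover have "\<bar>sin (f s / 2)\<bar> \<le> 1 / 4"
      using abs_sin_x_le_abs_x[of "f s / 2"] le[OF s] by simp
    then have "(sin (f s / 2))\<^sup>2 \<le> (1 / 4)\<^sup>2" by (metis abs_ge_zero power2_abs power_mono)
    ultimately show "\<bar>1 + (-1) * cos (f s)\<bar> \<le> 1 / 8" by (simp add: power2_eq_square)
  qed
  moreover have "norm (calc (\<lambda>s. sin (f s))) \<le> 1 / 2"
  proof (rule represents_norm_le[OF calc[OF cont(2)]])
    show "\<bar>sin (f s)\<bar> \<le> 1 / 2" if "s \<in> {-1..1}" for s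
      using abs_sin_x_le_abs_x[of "f s"] le[OF that] by linarith
  qed
  moreover have "1 - calc_exp f =
      (1 + (-1) *\<^sub>R calc (\<lambda>s. cos (f s))) - \<i> *\<^sub>C calc (\<lambda>s. sin (f s))"
    by (simp add: calc_exp_def)
  then have "norm (1 - calc_exp f) \<le>
      norm (1 + (-1) *\<^sub>R calc (\<lambda>s. cos (f s))) + norm (\<i> *\<^sub>C calc (\<lambda>s. sin (f s)))"
    by (metis norm_triangle_ineq4)
  ultimately show ?thesis by (simp add: norm_scaleC)
qed

lemma has_small_logarithm_calc_exp:
  assumes f: "continuous_on {-1..1} f" and le: "\<And>s. s \<in> {-1..1} \<Longrightarrow> \<bar>f s\<bar> \<le> 2 * pi"
  shows "has_small_logarithm (calc_exp f)"
proof -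
  \<comment> \<open>\<open>calc_exp g\<close> is an inverse sixteenth root of
    \<open>calc_exp f\<close>. Sixteen is enough, since \<open>2 * pi / 16 < 1 / 2\<close> by
    \<open>pi < 4\<close>.\<close>
  define g where "g s = - f s / 16" for s
  have g: "continuous_on {-1..1} g" unfolding g_def by (intro continuous_intros f) auto
  have iter: "((\<circ>\<^sub>J) (calc_exp g) ^^ n) (calc_exp f) = calc_exp (\<lambda>s. real n * g s + f s)" for n
  proof (induction n)
    case (Suc n)
    have "continuous_on {-1..1} (\<lambda>s. real n * g s + f s)" by (intro continuous_intros f g)
    from calc_exp_add[OF g this]
    have "((\<circ>\<^sub>J) (calc_exp g) ^^ Suc n) (calc_exp f) = calc_exp (\<lambda>s. g s + (real n * g s + f s))"
      by (simp only: funpow.simps comp_apply Suc)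
    also have "(\<lambda>s. g s + (real n * g s + f s)) = (\<lambda>s. real (Suc n) * g s + f s)"
      by (simp add: fun_eq_iff algebra_simps)
    finally show ?case .
  qed simp
  have "((\<circ>\<^sub>J) (calc_exp g) ^^ 16) (calc_exp f) = 1"
  proof -
    have "(\<lambda>s. real 16 * g s + f s) = (\<lambda>_. 0)" by (simp add: g_def)
    then show ?thesis unfolding iter by (simp only: calc_exp_zero)
  qed
  moreover have "norm (1 - calc_exp g) < 1"
  proof (rule norm_one_minus_calc_exp[OF g])
    show "\<bar>g s\<bar> \<le> 1 / 2" if "s \<in> {-1..1}" for s
      using le[OF that] pi_less_4 unfolding g_def by (simp only: abs_divide abs_minus_cancel)
  qed
  ultimately show ?thesis
    unfolding has_small_logarithm_def using norm_calc_exp[OF g] by (intro exI conjI)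
qed

end

section \<open>A criterion for the strong Mankiewicz property\<close>

lemma add_in_ball: "x + w \<in> ball x r \<longleftrightarrow> norm w < (r :: real)"
  and add_in_cball: "x + w \<in> cball x r \<longleftrightarrow> norm w \<le> r"
  for x w :: "'a::real_normed_vector"
  using dist_add_cancel[of x 0 w] by (simp_all add: dist_norm)

text \<open>After subtracting the chord, the norm of the defect \<open>D\<close> attains a maximum.
  If it is positive, its leftmost maximizer \<open>a\<close> is interior, and the midpoint rule
  makes the norm at \<open>a - e\<close> maximal too, a contradiction.\<close>

lemma locally_midpoint_affine_imp_affine:
  fixes g :: "real \<Rightarrow> 'b::real_normed_vector"
  assumes cont: "continuous_on {0..1} g" and d: "d > 0"
    and mid: "\<And>s e. \<lbrakk>0 \<le> s - e; s + e \<le> 1; 0 \<le> e; e < d\<rbrakk> \<Longrightarrow> g (s - e) + g (s + e) = 2 *\<^sub>R g s"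
    and s: "s \<in> {0..1}"
  shows "g s = (1 - s) *\<^sub>R g 0 + s *\<^sub>R g 1"
proof (rule ccontr)
  assume neq: "g s \<noteq> (1 - s) *\<^sub>R g 0 + s *\<^sub>R g 1"
  define D where "D s = g s - ((1 - s) *\<^sub>R g 0 + s *\<^sub>R g 1)" for s
  have contD: "continuous_on {0..1} (\<lambda>s. norm (D s))"
    unfolding D_def by (intro continuous_intros cont)
  obtain m where m: "m \<in> {0..1}" "\<And>r. r \<in> {0..1} \<Longrightarrow> norm (D r) \<le> norm (D m)"
    using continuous_attains_sup[OF _ _ contD] by auto
  define S where "S = {r \<in> {0..1}. norm (D r) = norm (D m)}"
  have "norm (D s) > 0" using neq by (simp add: D_def)
  then have pos: "norm (D m) > 0" using m(2)[OF s] by linarith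
  have "S = {0..1} \<inter> (\<lambda>s. norm (D s)) -` {norm (D m)}" by (auto simp: S_def)
  then have "closed S"
    using continuous_closed_preimage[OF contD closed_atLeastAtMost closed_singleton] by metis
  moreover have "bounded S" by (rule bounded_subset[OF bounded_closed_interval[of 0 1]]) (auto simp: S_def)
  ultimately have "compact S" by (simp add: compact_eq_bounded_closed)
  moreover have "S \<noteq> {}" using m by (auto simp: S_def)
  ultimately have "\<exists>a\<in>S. \<forall>r\<in>S. a \<le> r" by (rule compact_attains_inf)
  then obtain a where a: "a \<in> S" "\<And>r. r \<in> S \<Longrightarrow> a \<le> r" by blast
  have a01: "0 < a" "a < 1"
  proof -
    have "D 0 = 0" "D 1 = 0" by (simp_all add: D_def)
    moreover have "norm (D a) = norm (D m)" "a \<in> {0..1}" using a(1) by (simp_all add: S_def)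
    ultimately have "a \<noteq> 0" "a \<noteq> 1" using pos by auto
    then show "0 < a" "a < 1" using \<open>a \<in> {0..1}\<close> by simp_all
  qed
  define e where "e = min (d / 2) (min a (1 - a))"
  have e: "0 < e" "e < d" "0 \<le> a - e" "a + e \<le> 1" using d a01 by (auto simp: e_def)
  have "g (a - e) + g (a + e) = 2 *\<^sub>R g a" using mid e by simp
  then have "2 *\<^sub>R D a = D (a - e) + D (a + e)"
    by (simp add: D_def algebra_simps flip: scaleR_2) (simp add: scaleR_2, simp flip: scaleR_add_left)
  then have "2 * norm (D a) \<le> norm (D (a - e)) + norm (D (a + e))"
    by (metis norm_scaleR norm_triangle_ineq abs_numeral)
  moreover have "norm (D (a + e)) \<le> norm (D m)" using e by (intro m) auto
  moreover have "norm (D a) = norm (D m)" using a by (simp add: S_def)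
  moreover have "norm (D (a - e)) \<noteq> norm (D m)" using a(2)[of "a - e"] e by (auto simp: S_def)
  moreover have "norm (D (a - e)) \<le> norm (D m)" using e by (intro m) auto
  ultimately show False by linarith
qed

text \<open>A unit vector \<open>u\<close> is extreme in the unit ball iff \<open>x\<close> is the only metric midpoint of
  \<open>x - tu\<close> and \<open>x + tu\<close>. As \<open>L\<close> is convex, the midpoint of
  \<open>f (x \<plusminus> (tu + w))\<close> is some \<open>f z\<close>, and it turns out to be a metric midpoint of \<open>f (x \<plusminus> tu)\<close>.\<close>

lemma isometry_midpoint_add:
  fixes f :: "'a::real_normed_vector \<Rightarrow> 'b::real_normed_vector"
  assumes X: "subspace X" and L: "convex (f ` K)" and K: "K \<subseteq> X"
    and iso: "\<And>x y. \<lbrakk>x \<in> K; y \<in> K\<rbrakk> \<Longrightarrow> dist (f x) (f y) = dist x y"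
    and u: "u \<in> X" "norm u \<le> 1"
    and ext: "\<And>z. \<lbrakk>z \<in> X; norm (u + z) \<le> 1; norm (u - z) \<le> 1\<rbrakk> \<Longrightarrow> z = 0"
    and w: "w \<in> X" "norm w \<le> r" and t: "0 \<le> t"
    and IH: "\<And>x. \<lbrakk>x \<in> X; cball x r \<inter> X \<subseteq> K\<rbrakk> \<Longrightarrow> f (x + w) + f (x - w) = 2 *\<^sub>R f x"
    and x: "x \<in> X" "cball x (t + r) \<inter> X \<subseteq> K"
  shows "f (x + (t *\<^sub>R u + w)) + f (x - (t *\<^sub>R u + w)) = 2 *\<^sub>R f x"
proof -
  define v where "v = t *\<^sub>R u"
  have v: "v \<in> X" "norm v \<le> t"
    using X u t by (auto simp: v_def subspace_scale mult_left_le)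
  have r: "0 \<le> r" using w norm_ge_zero[of w] by linarith
  have inK: "x + a + b \<in> K" if "a \<in> X" "b \<in> X" "norm a \<le> t" "norm b \<le> r" for a b
  proof -
    have "norm (a + b) \<le> t + r" using that by (intro norm_triangle_le add_mono)
    moreover have "x + (a + b) \<in> X" using X x that by (intro subspace_add)
    ultimately have "x + (a + b) \<in> cball x (t + r) \<inter> X"
      by (simp only: Int_iff add_in_cball)
    then show ?thesis using x(2) by (auto simp: add.assoc)
  qed
  have neg: "- v \<in> X" "- w \<in> X" using X v w by (auto simp: subspace_neg)
  have ball: "cball (x + a) r \<inter> X \<subseteq> K" if "a \<in> X" "norm a \<le> t" for a
  proof
    fix y assume y: "y \<in> cball (x + a) r \<inter> X"
    have "norm (y - (x + a)) \<le> r" using y by (simp add: dist_norm norm_minus_commute)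
    moreover have "y - (x + a) \<in> X" using y X x that by (auto intro: subspace_diff subspace_add)
    ultimately have "x + a + (y - (x + a)) \<in> K" using that by (intro inK)
    then show "y \<in> K" by simp
  qed
  have plus: "f (x + v + w) + f (x + v - w) = 2 *\<^sub>R f (x + v)"
    using X x v ball by (intro IH subspace_add) auto
  have minus: "f (x - v + w) + f (x - v - w) = 2 *\<^sub>R f (x - v)"
    using X x v ball[of "- v"] neg by (intro IH subspace_diff) auto
  have P: "x + v + w \<in> K" "x + v - w \<in> K" "x - v + w \<in> K" "x - v - w \<in> K" "x + v \<in> K" "x - v \<in> K"
    using inK[of v w] inK[of v "- w"] inK[of "- v" w] inK[of "- v" "- w"] inK[of v 0] inK[of "- v" 0]
      v w neg X r by (auto simp: subspace_0)
  have xK: "x \<in> K" using inK[of 0 0] X r t by (simp add: subspace_0)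
  have "(1/2) *\<^sub>R f (x + v + w) + (1/2) *\<^sub>R f (x - v - w) \<in> f ` K"
    by (rule convexD[OF L]) (use P in auto)
  then obtain z where z: "z \<in> K" "f z = (1/2) *\<^sub>R (f (x + v + w) + f (x - v - w))"
    by (auto simp: scaleR_add_right)
  \<comment> \<open>Expanding \<open>f (x + v)\<close> by the hypothesis on \<open>w\<close> cancels
    \<open>f (x + v + w)\<close>; the two points that remain differ by \<open>2 v\<close>.\<close>
  have "f z - f (x + v) = (1/2) *\<^sub>R (f (x - v - w) - f (x + v - w))"
  proof -
    have "f (x + v) = (1/2) *\<^sub>R (f (x + v + w) + f (x + v - w))" unfolding plus by simp
    then show ?thesis by (simp add: z(2) algebra_simps)
  qed
  then have "dist z (x + v) = (1/2) * dist (x - v - w) (x + v - w)"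
    using iso[OF z(1) P(5)] iso[OF P(4) P(2)] by (simp add: dist_norm)
  also have "\<dots> = norm v"
    by (simp add: dist_norm flip: scaleR_2 norm_minus_cancel[of "- v - v"])
  finally have d1: "norm (z - x - v) \<le> t" using v by (simp add: dist_norm algebra_simps)
  have "f z - f (x - v) = (1/2) *\<^sub>R (f (x + v + w) - f (x - v + w))"
  proof -
    have "f (x - v) = (1/2) *\<^sub>R (f (x - v + w) + f (x - v - w))" unfolding minus by simp
    then show ?thesis by (simp add: z(2) algebra_simps)
  qed
  then have "dist z (x - v) = (1/2) * dist (x + v + w) (x - v + w)"
    using iso[OF z(1) P(6)] iso[OF P(1) P(3)] by (simp add: dist_norm)
  also have "\<dots> = norm v" by (simp add: dist_norm flip: scaleR_2)
  finally have d2: "norm (z - x + v) \<le> t" using v by (simp add: dist_norm algebra_simps)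
  have "z = x"
  proof (cases "t = 0")
    case True
    then show ?thesis using d1 by (simp add: v_def)
  next
    case False
    then have t: "t > 0" using t by simp
    define y where "y = (1 / t) *\<^sub>R (z - x)"
    have ty: "z - x = t *\<^sub>R y" using t by (simp add: y_def)
    have "t * norm (u + y) = norm (z - x + v)" "t * norm (u - y) = norm (z - x - v)"
      using t norm_minus_commute[of u y] unfolding ty v_def
      by (simp_all add: add.commute flip: scaleR_add_right scaleR_diff_right)
    then have "t * norm (u + y) \<le> t * 1" "t * norm (u - y) \<le> t * 1" using d1 d2 by simp_all
    then have "norm (u + y) \<le> 1" "norm (u - y) \<le> 1" using t by (simp_all only: mult_le_cancel_left_pos)
    moreover have "y \<in> X" using X K z x by (auto simp: y_def intro: subspace_scale subspace_diff)
    ultimately have "y = 0" by (intro ext)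
    then show ?thesis using ty by simp
  qed
  then show ?thesis using z(2) by (simp add: v_def add.assoc diff_diff_eq)
qed

text \<open>The weights are rescaled to sum to \<open>r\<close> because the midpoint induction uses
  up exactly this much room around its centre.\<close>

lemma convex_hull_scaleE:
  fixes w :: "'a::real_vector"
  assumes "w \<in> convex hull E" and "0 \<le> r"
  obtains n :: nat and c u where "\<And>i. i < n \<Longrightarrow> 0 \<le> c i \<and> u i \<in> E" "(\<Sum>i<n. c i) = r"
    "r *\<^sub>R w = (\<Sum>i<n. c i *\<^sub>R u i)"
proof -
  obtain k c u where *: "\<forall>i\<in>{1..k::nat}. 0 \<le> c i \<and> u i \<in> E" "sum c {1..k} = 1"
      "(\<Sum>i = 1..k. c i *\<^sub>R u i) = w"
    using assms(1) unfolding convex_hull_indexed by blast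
  show ?thesis
  proof (rule that[of k "\<lambda>i. r * c (Suc i)" "\<lambda>i. u (Suc i)"])
    show "0 \<le> r * c (Suc i) \<and> u (Suc i) \<in> E" if "i < k" for i using *(1) assms(2) that by auto
    have "(\<Sum>i<k. c (Suc i)) = 1" using *(2) by (simp add: sum.atLeast1_atMost_eq)
    then show "(\<Sum>i<k. r * c (Suc i)) = r" by (metis sum_distrib_left mult.right_neutral)
    have "(\<Sum>i<k. c (Suc i) *\<^sub>R u (Suc i)) = w" using *(3) by (simp add: sum.atLeast1_atMost_eq)
    then show "r *\<^sub>R w = (\<Sum>i<k. (r * c (Suc i)) *\<^sub>R u (Suc i))"
      by (metis (no_types, lifting) scaleR_sum_right scaleR_scaleR sum.cong)
  qed
qed

text \<open>If both endpoints have room \<open>R\<close> in \<open>K\<close>, convexity gives that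
  room along the whole segment, so the midpoint rule holds there with one step size. The other
  points of \<open>K\<close> are limits of such points, obtained by shrinking towards
  \<open>c\<close>.\<close>

theorem strong_mankiewicz_if_ball_in_convex_hull_of_extreme:
  fixes X E :: "'a::real_normed_vector set"
  assumes X: "subspace X"
    and E: "\<And>u. u \<in> E \<Longrightarrow> u \<in> X \<and> norm u \<le> 1"
    and ext: "\<And>u z. \<lbrakk>u \<in> E; z \<in> X; norm (u + z) \<le> 1; norm (u - z) \<le> 1\<rbrakk> \<Longrightarrow> z = 0"
    and \<delta>: "\<delta> > 0" and hull: "\<And>w. \<lbrakk>w \<in> X; norm w < \<delta>\<rbrakk> \<Longrightarrow> w \<in> convex hull E"
    and body: "convex_body X K"
  shows "strong_mankiewicz TYPE('b::real_normed_vector) K"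
  unfolding strong_mankiewicz_def
proof (intro allI impI)
  fix L :: "'b set" and f
  assume L: "convex L" and fK: "f ` K = L" and "\<forall>x\<in>K. \<forall>y\<in>K. dist (f x) (f y) = dist x y"
  then have iso: "\<And>x y. \<lbrakk>x \<in> K; y \<in> K\<rbrakk> \<Longrightarrow> dist (f x) (f y) = dist x y" and L: "convex (f ` K)"
    by blast+
  have K: "K \<subseteq> X" "convex K" using body by (auto simp: convex_body_def)
  have contf: "continuous_on K f"
    unfolding continuous_on_iff using iso by (metis dist_commute)
  have mid_sum: "f (x + (\<Sum>i<n. c i *\<^sub>R u i)) + f (x - (\<Sum>i<n. c i *\<^sub>R u i)) = 2 *\<^sub>R f x"
    if "\<And>i. i < n \<Longrightarrow> 0 \<le> c i \<and> u i \<in> E" "x \<in> X" "cball x (\<Sum>i<n. c i) \<inter> X \<subseteq> K"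
    for n :: nat and c u x
    using that
  proof (induction n arbitrary: x)
    case 0
    then show ?case by (simp add: scaleR_2)
  next
    case (Suc n)
    define w where "w = (\<Sum>i<n. c i *\<^sub>R u i)"
    have w: "w \<in> X" using Suc.prems(1) E X
      unfolding w_def by (intro subspace_sum subspace_scale) auto
    have nw: "norm w \<le> (\<Sum>i<n. c i)"
      unfolding w_def using Suc.prems(1) E
      by (intro sum_norm_le) (auto intro!: mult_left_le)
    have IH: "f (y + w) + f (y - w) = 2 *\<^sub>R f y" if "y \<in> X" "cball y (\<Sum>i<n. c i) \<inter> X \<subseteq> K" for y
      unfolding w_def using that Suc.prems(1) by (intro Suc.IH) auto
    have "u n \<in> E" "0 \<le> c n" using Suc.prems(1) by auto
    then have "f (x + (c n *\<^sub>R u n + w)) + f (x - (c n *\<^sub>R u n + w)) = 2 *\<^sub>R f x"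
      using E ext Suc.prems(2,3)
      by (intro isometry_midpoint_add[OF X L K(1) iso _ _ _ w nw _ IH]) (auto simp: add.commute)
    then show ?case by (simp add: w_def add.commute)
  qed
  have mid: "f (x + w) + f (x - w) = 2 *\<^sub>R f x"
    if x: "x \<in> X" "ball x R \<inter> X \<subseteq> K" and w: "w \<in> X" "norm w < \<delta> * R" for x w R
  proof -
    \<comment> \<open>The strict gap keeps \<open>(1 / r) *\<^sub>R w\<close> below
      \<open>\<delta>\<close> in norm while the closed ball of radius \<open>r\<close> stays inside
      the open one of radius \<open>R\<close>.\<close>
    obtain r where r: "norm w / \<delta> < r" "r < R"
      using dense[of "norm w / \<delta>" R] w(2) \<delta> by (auto simp: pos_divide_less_eq mult.commute)
    have r0: "0 < r" using r(1) \<delta> by (meson divide_nonneg_pos le_less_trans norm_ge_zero)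
    have "norm ((1 / r) *\<^sub>R w) < \<delta>" using r r0 \<delta> by (simp add: pos_divide_less_eq mult.commute)
    then have "(1 / r) *\<^sub>R w \<in> convex hull E" using X w by (intro hull subspace_scale)
    then obtain n :: nat and c u where cu: "\<And>i. i < n \<Longrightarrow> 0 \<le> c i \<and> u i \<in> E" "(\<Sum>i<n. c i) = r"
        "r *\<^sub>R (1 / r) *\<^sub>R w = (\<Sum>i<n. c i *\<^sub>R u i)"
      using convex_hull_scaleE[of "(1 / r) *\<^sub>R w" E r] r0 by (metis less_imp_le)
    have "cball x r \<inter> X \<subseteq> K" using x(2) r(2) by auto
    then show ?thesis using mid_sum[OF cu(1) x(1)] cu r0 by simp
  qed
  define I where "I = {x \<in> X. \<exists>R>0. ball x R \<inter> X \<subseteq> K}"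
  have IK: "I \<subseteq> K" by (auto simp: I_def)
  have affine_I: "f ((1 - t) *\<^sub>R a + t *\<^sub>R b) = (1 - t) *\<^sub>R f a + t *\<^sub>R f b"
    if "a \<in> I" "b \<in> I" "t \<in> {0..1}" for a b t
  proof -
    obtain R1 R2 where R12: "R1 > 0" "ball a R1 \<inter> X \<subseteq> K" "R2 > 0" "ball b R2 \<inter> X \<subseteq> K"
      using \<open>a \<in> I\<close> \<open>b \<in> I\<close> unfolding I_def by blast
    define R where "R = min R1 R2"
    have R: "R > 0" "ball a R \<inter> X \<subseteq> K" "ball b R \<inter> X \<subseteq> K" using R12 by (auto simp: R_def)
    have ab: "a \<in> X" "b \<in> X" using that by (auto simp: I_def)
    define p where "p s = (1 - s) *\<^sub>R a + s *\<^sub>R b" for s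
    have pX: "p s \<in> X" for s unfolding p_def using X ab by (intro subspace_add subspace_scale)
    have pball: "ball (p s) R \<inter> X \<subseteq> K" if "s \<in> {0..1}" for s
    proof
      fix y assume y: "y \<in> ball (p s) R \<inter> X"
      define w where "w = y - p s"
      have w: "w \<in> X" "norm w < R"
        using y pX X by (auto simp: w_def dist_norm norm_minus_commute intro: subspace_diff)
      have "a + w \<in> K" "b + w \<in> K" using R w X ab add_in_ball[of _ w R] by (blast intro: subspace_add)+
      then have "(1 - s) *\<^sub>R (a + w) + s *\<^sub>R (b + w) \<in> K" using that by (intro convexD[OF K(2)]) auto
      moreover have "(1 - s) *\<^sub>R (a + w) + s *\<^sub>R (b + w) = y" by (simp add: w_def p_def algebra_simps)
      ultimately show "y \<in> K" by simp
    qed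
    have pK: "p s \<in> K" if "s \<in> {0..1}" for s using pball[OF that] pX R(1) by auto
    \<comment> \<open>Keeps each displacement \<open>e *\<^sub>R (b - a)\<close> with
      \<open>e < d\<close> below \<open>\<delta> * R\<close>; the 1 in the denominator covers
      \<open>a = b\<close>.\<close>
    define d where "d = \<delta> * R / (norm (b - a) + 1)"
    have d: "d > 0" using \<delta> R(1) by (simp add: d_def add_nonneg_pos)
    have "f (p t) = (1 - t) *\<^sub>R f (p 0) + t *\<^sub>R f (p 1)"
    proof (rule locally_midpoint_affine_imp_affine[of "\<lambda>s. f (p s)", OF _ d _ that(3)])
      have "continuous_on {0..1} p" unfolding p_def by (intro continuous_intros)
      then show "continuous_on {0..1} (\<lambda>s. f (p s))"
        by (rule continuous_on_compose2[OF contf]) (use pK in auto)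
      fix s e :: real assume se: "0 \<le> s - e" "s + e \<le> 1" "0 \<le> e" "e < d"
      have "norm (e *\<^sub>R (b - a)) \<le> e * (norm (b - a) + 1)" using se by (simp add: distrib_left)
      also have "\<dots> < d * (norm (b - a) + 1)"
        using se by (intro mult_strict_right_mono) (auto simp: add_nonneg_pos)
      also have "\<dots> = \<delta> * R"
        using norm_ge_zero[of "b - a"] unfolding d_def by (subst nonzero_eq_divide_eq[symmetric]) linarith+
      finally have "norm (e *\<^sub>R (b - a)) < \<delta> * R" .
      then have "f (p s + e *\<^sub>R (b - a)) + f (p s - e *\<^sub>R (b - a)) = 2 *\<^sub>R f (p s)"
        using se X ab by (intro mid[OF pX pball] subspace_scale subspace_diff) auto
      moreover have "p s + e *\<^sub>R (b - a) = p (s + e)" "p s - e *\<^sub>R (b - a) = p (s - e)"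
        by (simp_all add: p_def algebra_simps)
      ultimately show "f (p (s - e)) + f (p (s + e)) = 2 *\<^sub>R f (p s)" by (simp add: add.commute)
    qed
    then show ?thesis by (simp add: p_def)
  qed
  obtain c where c: "c \<in> I"
  proof -
    obtain c T where "c \<in> T" "openin (top_of_set X) T" "T \<subseteq> K"
      using body by (auto simp: convex_body_def interior_of_def)
    then obtain R where "R > 0" "ball c R \<inter> X \<subseteq> T" "c \<in> X"
      by (metis openin_contains_ball openin_subset subsetD topspace_euclidean_subtopology)
    then have "c \<in> I" using \<open>T \<subseteq> K\<close> by (auto simp: I_def)
    then show ?thesis by (rule that)
  qed
  have shrink: "(1 - s) *\<^sub>R x + s *\<^sub>R c \<in> I" if x: "x \<in> K" and s: "0 < s" "s \<le> 1" for x s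
  proof -
    obtain R where R: "R > 0" "ball c R \<inter> X \<subseteq> K" "c \<in> X" using c by (auto simp: I_def)
    have xX: "x \<in> X" using x K by auto
    have mem: "(1 - s) *\<^sub>R x + s *\<^sub>R c \<in> X" using X xX R by (intro subspace_add subspace_scale)
    have "ball ((1 - s) *\<^sub>R x + s *\<^sub>R c) (s * R) \<inter> X \<subseteq> K"
    proof
      fix y assume y: "y \<in> ball ((1 - s) *\<^sub>R x + s *\<^sub>R c) (s * R) \<inter> X"
      define w where "w = (1 / s) *\<^sub>R (y - ((1 - s) *\<^sub>R x + s *\<^sub>R c))"
      have "w \<in> X" unfolding w_def using y mem X by (auto intro: subspace_scale subspace_diff)
      moreover have "norm w < R"
        using y s by (simp add: w_def dist_norm norm_minus_commute pos_divide_less_eq mult.commute)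
      ultimately have "c + w \<in> K" using R X add_in_ball[of c w R] by (blast intro: subspace_add)
      then have "(1 - s) *\<^sub>R x + s *\<^sub>R (c + w) \<in> K" using s x by (intro convexD[OF K(2)]) auto
      moreover have "(1 - s) *\<^sub>R x + s *\<^sub>R (c + w) = y" using s by (simp add: w_def scaleR_add_right)
      ultimately show "y \<in> K" by simp
    qed
    then show ?thesis using mem s R(1) by (auto simp: I_def intro!: exI[of _ "s * R"])
  qed
  show "affine_map_on K f"
    unfolding affine_map_on_def
  proof (intro ballI)
    fix x y :: 'a and t :: real assume x: "x \<in> K" and y: "y \<in> K" and t: "t \<in> {0..1}"
    define s where "s n = inverse (real (Suc n))" for n
    have s: "0 < s n" "s n \<le> 1" for n by (auto simp: s_def divide_simps)
    have lim0: "s \<longlonglongrightarrow> 0" unfolding s_def by (rule LIMSEQ_inverse_real_of_nat)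
    have lim: "(\<lambda>n. f ((1 - s n) *\<^sub>R z + s n *\<^sub>R c)) \<longlonglongrightarrow> f z" if z: "z \<in> K" for z
    proof (rule continuous_on_tendsto_compose[OF contf _ z])
      have "(\<lambda>n. (1 - s n) *\<^sub>R z + s n *\<^sub>R c) \<longlonglongrightarrow> (1 - 0) *\<^sub>R z + 0 *\<^sub>R c"
        by (intro tendsto_intros lim0)
      then show "(\<lambda>n. (1 - s n) *\<^sub>R z + s n *\<^sub>R c) \<longlonglongrightarrow> z" by simp
      show "\<forall>\<^sub>F n in sequentially. (1 - s n) *\<^sub>R z + s n *\<^sub>R c \<in> K"
        using shrink[OF z s] IK by (intro always_eventually) auto
    qed
    define z where "z = (1 - t) *\<^sub>R x + t *\<^sub>R y"
    have z: "z \<in> K" unfolding z_def using t by (intro convexD[OF K(2)] x y) auto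
    have "f ((1 - s n) *\<^sub>R z + s n *\<^sub>R c) = (1 - t) *\<^sub>R f ((1 - s n) *\<^sub>R x + s n *\<^sub>R c) +
        t *\<^sub>R f ((1 - s n) *\<^sub>R y + s n *\<^sub>R c)" for n
      using affine_I[OF shrink[OF x s] shrink[OF y s] t, of n n]
      by (simp add: z_def algebra_simps)
    then have "(\<lambda>n. f ((1 - s n) *\<^sub>R z + s n *\<^sub>R c)) \<longlonglongrightarrow> (1 - t) *\<^sub>R f x + t *\<^sub>R f y"
      using tendsto_add[OF tendsto_scaleR[OF tendsto_const lim[OF x]] tendsto_scaleR[OF tendsto_const lim[OF y]]]
      by simp
    then show "f ((1 - t) *\<^sub>R x + t *\<^sub>R y) = (1 - t) *\<^sub>R f x + t *\<^sub>R f y"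
      using LIMSEQ_unique[OF lim[OF z]] by (simp add: z_def)
  qed
qed

section \<open>Characters\<close>

locale jordan_character =
  fixes \<psi> :: "'a::unital_jb_star_algebra \<Rightarrow> complex"
  assumes hom: "jordan_star_hom \<psi>" and nonzero: "\<psi> \<noteq> (\<lambda>_. 0)"
begin

lemma \<psi>_add: "\<psi> (x + y) = \<psi> x + \<psi> y"
  and \<psi>_scaleC: "\<psi> (c *\<^sub>C x) = c * \<psi> x"
  and \<psi>_mult: "\<psi> (x \<circ>\<^sub>J y) = \<psi> x * \<psi> y"
  and \<psi>_star: "\<psi> (star x) = cnj (\<psi> x)"
  using hom by (auto simp: jordan_star_hom_def scaleC_complex_def jordan_complex_def star_complex_def)

lemma \<psi>_scaleR: "\<psi> (r *\<^sub>R x) = r * \<psi> x"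
  by (metis \<psi>_scaleC scaleC_of_real)

lemma \<psi>_one: "\<psi> 1 = 1"
proof -
  obtain x where x: "\<psi> x \<noteq> 0" using nonzero by auto
  have "\<psi> 1 * \<psi> x = \<psi> x" using \<psi>_mult[of 1 x] by simp
  then show ?thesis using x by simp
qed

text \<open>If \<open>\<psi> x = 1\<close> with \<open>\<parallel>x\<parallel> < 1\<close>, then \<open>\<psi>\<close> has no possible value at the solution \<open>y\<close> of
  \<open>y = 1 + x \<circ> y\<close>.\<close>

lemma norm_\<psi>_le: "cmod (\<psi> x) \<le> norm x"
proof (rule ccontr)
  assume "\<not> cmod (\<psi> x) \<le> norm x"
  then have less: "norm x < cmod (\<psi> x)" by simp
  then have nz: "\<psi> x \<noteq> 0" by force
  define a where "a = inverse (\<psi> x) *\<^sub>C x"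
  have a1: "\<psi> a = 1" using nz by (simp add: a_def \<psi>_scaleC)
  have "norm a = norm x / cmod (\<psi> x)"
    by (simp add: a_def norm_scaleC norm_inverse divide_inverse mult.commute)
  then have na: "norm a < 1" using less nz by simp
  have "\<exists>!y\<in>UNIV. 1 + a \<circ>\<^sub>J y = y"
  proof (rule Banach_fix[OF complete_UNIV _ norm_ge_zero na])
    show "dist (1 + a \<circ>\<^sub>J y) (1 + a \<circ>\<^sub>J z) \<le> norm a * dist y z" for y z
      using norm_jordan_le[of a "y - z"] by (simp add: dist_norm jordan_diff_right)
  qed auto
  then obtain y where "1 + a \<circ>\<^sub>J y = y" by auto
  then have "\<psi> (1 + a \<circ>\<^sub>J y) = \<psi> y" by simp
  then show False by (simp add: \<psi>_add \<psi>_mult \<psi>_one a1)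
qed

lemma \<psi>_tendsto: "X \<longlonglongrightarrow> x \<Longrightarrow> (\<lambda>n. \<psi> (X n)) \<longlonglongrightarrow> \<psi> x"
proof -
  have "bounded_linear \<psi>"
    by (rule bounded_linear_intro[where K = 1])
      (simp_all add: \<psi>_add \<psi>_scaleR scaleR_conv_of_real norm_\<psi>_le)
  then show "X \<longlonglongrightarrow> x \<Longrightarrow> (\<lambda>n. \<psi> (X n)) \<longlonglongrightarrow> \<psi> x" by (rule bounded_linear.tendsto)
qed

definition real_algebra :: "'a set" where
  "real_algebra = \<psi> -` \<real>"

lemma subspace_real_algebra: "subspace real_algebra"
proof (rule subspaceI)
  show "0 \<in> real_algebra" using \<psi>_scaleR[of 0 0] by (simp add: real_algebra_def)
  show "x + y \<in> real_algebra" if "x \<in> real_algebra" "y \<in> real_algebra" for x y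
    using that by (simp add: real_algebra_def \<psi>_add Reals_add)
  show "c *\<^sub>R x \<in> real_algebra" if "x \<in> real_algebra" for c x
    using that by (simp add: real_algebra_def \<psi>_scaleR Reals_mult)
qed

lemma real_jb_star_algebra_real_algebra: "real_jb_star_algebra real_algebra"
proof -
  have "closed real_algebra"
    unfolding closed_sequential_limits
  proof (intro allI impI, elim conjE)
    fix X x assume X: "\<forall>n. X n \<in> real_algebra" and lim: "X \<longlonglongrightarrow> x"
    have "\<psi> x \<in> \<real>"
      by (rule closed_sequentially[OF closed_complex_Reals _ \<psi>_tendsto[OF lim]])
        (use X in \<open>simp add: real_algebra_def\<close>)
    then show "x \<in> real_algebra" by (simp add: real_algebra_def)
  qed
  moreover have "star x \<in> real_algebra" if "x \<in> real_algebra" for x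
    using that by (simp add: real_algebra_def \<psi>_star complex_is_Real_iff)
  moreover have "x \<circ>\<^sub>J y \<in> real_algebra" if "x \<in> real_algebra" "y \<in> real_algebra" for x y
    using that by (simp add: real_algebra_def \<psi>_mult Reals_mult)
  ultimately show ?thesis
    unfolding real_jb_star_algebra_def using subspace_real_algebra by blast
qed

text \<open>The unitaries whose extremality in the unit ball is at hand; the norm bound is carried
  along instead of being derived from unitarity.\<close>

definition logarithmic_unitaries :: "'a set" where
  "logarithmic_unitaries = {u \<in> unitaries real_algebra. has_small_logarithm u \<and> norm u \<le> 1}"

lemma mem_logarithmic_unitaries:
  "u \<in> logarithmic_unitaries \<longleftrightarrow> u \<in> real_algebra \<and> jordan_inverse u (star u) \<and>
    has_small_logarithm u \<and> norm u \<le> 1"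
  by (simp add: logarithmic_unitaries_def unitaries_def)

end

section \<open>A character under the functional calculus\<close>

locale jordan_character_contraction = jordan_character \<psi> + hermitian_contraction h
  for \<psi> :: "'a::unital_jb_star_algebra \<Rightarrow> complex" and h :: 'a
begin

definition t :: real where "t = Re (\<psi> h)"

lemma \<psi>_h: "\<psi> h = complex_of_real t"
  using \<psi>_star[of h] by (simp add: t_def star_h complex_eq_iff)

lemma t_mem: "t \<in> {-1..1}"
proof -
  have "\<bar>t\<bar> \<le> 1" using norm_\<psi>_le[of h] norm_h by (simp add: \<psi>_h)
  then show ?thesis by auto
qed

lemma \<psi>_jordan_poly: "\<psi> (jordan_poly h p) = complex_of_real (poly p t)"
proof (induction p)
  case 0
  then show ?case using \<psi>_scaleR[of 0 0] by simp
next
  case (pCons a p)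
  then show ?case by (simp add: \<psi>_add \<psi>_scaleR \<psi>_mult \<psi>_one \<psi>_h)
qed

text \<open>\<open>t\<close> acts as the point of the spectrum at which \<open>\<psi>\<close>
  evaluates; continuity of \<open>\<psi>\<close> extends this from polynomials.\<close>

lemma \<psi>_calc:
  assumes g: "continuous_on {-1..1} g"
  shows "\<psi> (calc g) = complex_of_real (g t)"
proof -
  obtain P where P: "uniform_limit {-1..1} (\<lambda>n. poly (P n)) g sequentially"
      "(\<lambda>n. jordan_poly h (P n)) \<longlonglongrightarrow> calc g"
    using calc[OF g] unfolding represents_def by metis
  have "(\<lambda>n. complex_of_real (poly (P n) t)) \<longlonglongrightarrow> complex_of_real (g t)"
    by (intro tendsto_of_real tendsto_uniform_limitI[OF P(1) t_mem])
  moreover have "(\<lambda>n. complex_of_real (poly (P n) t)) \<longlonglongrightarrow> \<psi> (calc g)"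
    using \<psi>_tendsto[OF P(2)] by (simp add: \<psi>_jordan_poly)
  ultimately show ?thesis using LIMSEQ_unique by blast
qed

text \<open>\<open>\<psi>\<close> maps the exponential to \<open>exp (\<i> g(t))\<close>, which is
  real because its sine vanishes. The bound \<open>2 * pi\<close> is inherited from
  \<open>has_small_logarithm_calc_exp\<close>.\<close>

lemma calc_exp_logarithmic_unitary:
  assumes g: "continuous_on {-1..1} g" and le: "\<And>s. s \<in> {-1..1} \<Longrightarrow> \<bar>g s\<bar> \<le> 2 * pi"
    and sin: "sin (g t) = 0"
  shows "calc_exp g \<in> logarithmic_unitaries"
proof -
  have "\<psi> (calc_exp g) = complex_of_real (cos (g t))"
    by (simp only: calc_exp_def \<psi>_add \<psi>_scaleC \<psi>_calc[OF continuous_on_cos[OF g]]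
        \<psi>_calc[OF continuous_on_sin[OF g]] sin) simp
  then have "calc_exp g \<in> real_algebra" by (simp add: real_algebra_def)
  moreover have "has_small_logarithm (calc_exp g)" by (rule has_small_logarithm_calc_exp[OF g le])
  moreover note jordan_inverse_calc_exp[OF g] norm_calc_exp[OF g]
  ultimately show ?thesis unfolding mem_logarithmic_unitaries by (intro conjI)
qed

text \<open>With \<open>g = cos \<theta>\<close>, \<open>g(h)\<close> is the mean of
  \<open>exp (\<plusminus> \<i> \<theta>(h))\<close>. At \<open>t\<close> the cosine is 1 or -1, so
  the sine vanishes and \<open>\<psi>\<close> is real on both exponentials.\<close>

lemma calc_in_hull:
  assumes g: "continuous_on {-1..1} g" and le: "\<And>s. s \<in> {-1..1} \<Longrightarrow> \<bar>g s\<bar> \<le> 1"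
    and gt: "g t = 1 \<or> g t = -1"
  shows "calc g \<in> convex hull logarithmic_unitaries"
proof -
  define \<theta> where "\<theta> s = arccos (g s)" for s
  have range: "-1 \<le> g s" "g s \<le> 1" if "s \<in> {-1..1}" for s
    using le[OF that] by linarith+
  have \<theta>: "continuous_on {-1..1} \<theta>"
    unfolding \<theta>_def using range by (intro continuous_on_arccos g) blast
  have cos_\<theta>: "cos (\<theta> s) = g s" if "s \<in> {-1..1}" for s
    using le[OF that] by (simp add: \<theta>_def cos_arccos_abs)
  have bound: "\<bar>\<theta> s\<bar> \<le> 2 * pi" if "s \<in> {-1..1}" for s
    using arccos_bounded[OF range[OF that]] pi_ge_zero unfolding \<theta>_def by linarith
  have "(sin (\<theta> t))\<^sup>2 = 0"
    using gt cos_\<theta>[OF t_mem] sin_cos_squared_add[of "\<theta> t"] by auto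
  then have sin: "sin (\<theta> t) = 0" by simp
  have "calc_exp \<theta> \<in> logarithmic_unitaries" "calc_exp (\<lambda>s. - \<theta> s) \<in> logarithmic_unitaries"
    using bound sin by (auto intro!: calc_exp_logarithmic_unitary \<theta> continuous_on_minus)
  then have "(1/2) *\<^sub>R calc_exp \<theta> + (1/2) *\<^sub>R calc_exp (\<lambda>s. - \<theta> s) \<in> convex hull logarithmic_unitaries"
    by (intro convexD[OF convex_convex_hull] hull_inc) auto
  also have "(1/2) *\<^sub>R calc_exp \<theta> + (1/2) *\<^sub>R calc_exp (\<lambda>s. - \<theta> s) = calc (\<lambda>s. cos (\<theta> s))"
  proof -
    have "calc (\<lambda>s. sin (- \<theta> s)) = - calc (\<lambda>s. sin (\<theta> s))"
      using calc_scaleR[OF continuous_on_sin[OF \<theta>], of "-1"] by simp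
    then show ?thesis
      by (simp add: calc_exp_def scaleC_minus_right algebra_simps flip: scaleR_add_left)
  qed
  also have "calc (\<lambda>s. cos (\<theta> s)) = calc g"
    by (rule calc_unique[OF calc[OF g] continuous_on_cos[OF \<theta>] cos_\<theta>])
  finally show ?thesis .
qed

text \<open>The two functions below have values \<open>1\<close> and \<open>-1\<close> at \<open>t\<close>; their weighted mean is the identity
  because one of them is constant on either side of \<open>t\<close>.\<close>

lemma h_in_hull:
  assumes t1: "\<bar>t\<bar> < 1"
  shows "h \<in> convex hull logarithmic_unitaries"
proof -
  \<comment> \<open>\<open>f\<close> rises from -1 at -1 to 1 at \<open>t\<close> and stays there;
    \<open>g\<close> is -1 up to \<open>t\<close> and rises to 1 at 1. The weights
    \<open>(1 + t) / 2\<close> and \<open>(1 - t) / 2\<close> are those that produce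
    \<open>t\<close> from the values 1 and -1.\<close>
  define f where "f s = min 1 ((2 * s + 1 - t) / (1 + t))" for s
  define g where "g s = max (-1) ((2 * s - 1 - t) / (1 - t))" for s
  have pos: "1 + t > 0" "1 - t > 0" using t1 by auto
  have f: "continuous_on {-1..1} f" unfolding f_def using pos by (intro continuous_intros) auto
  have g: "continuous_on {-1..1} g" unfolding g_def using pos by (intro continuous_intros) auto
  have "\<bar>f s\<bar> \<le> 1" if "s \<in> {-1..1}" for s
  proof -
    have "-1 \<le> (2 * s + 1 - t) / (1 + t)" using that pos by (subst pos_le_divide_eq) auto
    then show ?thesis unfolding f_def by (simp add: abs_le_iff minus_le_iff)
  qed
  moreover have "f t = 1" using pos by (simp add: f_def)
  ultimately have 1: "calc f \<in> convex hull logarithmic_unitaries" by (intro calc_in_hull f) auto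
  have "\<bar>g s\<bar> \<le> 1" if "s \<in> {-1..1}" for s
  proof -
    have "(2 * s - 1 - t) / (1 - t) \<le> 1" using that pos by (subst pos_divide_le_eq) auto
    then show ?thesis unfolding g_def by (simp add: abs_le_iff minus_le_iff)
  qed
  moreover have "g t = -1"
  proof -
    have "(2 * t - 1 - t) / (1 - t) = -1" using pos by (simp add: field_simps)
    then show ?thesis by (simp add: g_def)
  qed
  ultimately have 2: "calc g \<in> convex hull logarithmic_unitaries" by (intro calc_in_hull g) auto
  have "((1 + t) / 2) *\<^sub>R calc f + ((1 - t) / 2) *\<^sub>R calc g \<in> convex hull logarithmic_unitaries"
    using pos by (intro convexD[OF convex_convex_hull] 1 2) (auto simp: field_simps)
  also have "((1 + t) / 2) *\<^sub>R calc f + ((1 - t) / 2) *\<^sub>R calc g = h"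
  proof (rule represents_unique[OF _ represents_id])
    show "represents (((1 + t) / 2) *\<^sub>R calc f + ((1 - t) / 2) *\<^sub>R calc g)
        (\<lambda>s. ((1 + t) / 2) * f s + ((1 - t) / 2) * g s)"
      by (intro represents_add represents_scaleR calc f g)
    show "((1 + t) / 2) * f s + ((1 - t) / 2) * g s = s" for s
    proof (cases "s \<le> t")
      case True
      then have "f s = (2 * s + 1 - t) / (1 + t)" "g s = -1"
        using pos by (auto simp: f_def g_def field_simps)
      then show ?thesis using pos by (simp add: field_simps)
    next
      case False
      then have "f s = 1" "g s = (2 * s - 1 - t) / (1 - t)"
        using pos by (auto simp: f_def g_def field_simps)
      then show ?thesis using pos by (simp add: field_simps)
    qed
  qed
  finally show ?thesis .
qed

lemma ii_h_in_hull:
  assumes t0: "t = 0"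
  shows "\<i> *\<^sub>C h \<in> convex hull logarithmic_unitaries"
proof -
  define f where "f s = arcsin s" for s
  have f: "continuous_on {-1..1} f" unfolding f_def by (intro continuous_intros) auto
  \<comment> \<open>\<open>exp (\<i> (pi - f)) = - exp (- \<i> f)\<close>: in the mean the cosines
    cancel and the sines agree. At \<open>t = 0\<close> both sines vanish.\<close>
  define g where "g s = pi - f s" for s
  have g: "continuous_on {-1..1} g" unfolding g_def by (intro continuous_intros f)
  have sin_f: "sin (f s) = s" if "s \<in> {-1..1}" for s using that by (simp add: f_def)
  have f_bound: "\<bar>f s\<bar> \<le> pi / 2" if "s \<in> {-1..1}" for s
    using that arcsin_bounded[of s] unfolding f_def atLeastAtMost_iff by linarith
  have bound: "\<bar>f s\<bar> \<le> 2 * pi" "\<bar>g s\<bar> \<le> 2 * pi" if "s \<in> {-1..1}" for s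
    using f_bound[OF that] pi_ge_zero unfolding g_def by linarith+
  have "calc_exp f \<in> logarithmic_unitaries" "calc_exp g \<in> logarithmic_unitaries"
    using bound t0 by (auto intro!: calc_exp_logarithmic_unitary f g simp: g_def f_def)
  then have "(1/2) *\<^sub>R calc_exp f + (1/2) *\<^sub>R calc_exp g \<in> convex hull logarithmic_unitaries"
    by (intro convexD[OF convex_convex_hull] hull_inc) auto
  also have "(1/2) *\<^sub>R calc_exp f + (1/2) *\<^sub>R calc_exp g = \<i> *\<^sub>C h"
  proof -
    have s: "calc (\<lambda>s. sin (f s)) = h"
      by (rule calc_unique[OF represents_id continuous_on_sin[OF f] sin_f])
    have "(\<lambda>s. cos (g s)) = (\<lambda>s. (-1) * cos (f s))" "(\<lambda>s. sin (g s)) = (\<lambda>s. sin (f s))"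
      by (simp_all add: g_def)
    then have "calc_exp g = (-1) *\<^sub>R calc (\<lambda>s. cos (f s)) + \<i> *\<^sub>C h"
      by (simp only: calc_exp_def s calc_scaleR[OF continuous_on_cos[OF f]])
    moreover have "calc_exp f = calc (\<lambda>s. cos (f s)) + \<i> *\<^sub>C h" by (simp only: calc_exp_def s)
    ultimately show ?thesis by (simp flip: scaleR_add_right)
  qed
  finally show ?thesis .
qed

end

section \<open>The half ball and the convex bodies of the real algebra\<close>

context jordan_character
begin

text \<open>The strict norm bound gives \<open>\<bar>h.t\<bar> < 1\<close>, which
  \<open>h_in_hull\<close> needs. No closure is taken, so the result feeds the Mankiewicz
  criterion.\<close>

lemma half_open_ball_in_hull:
  assumes x: "x \<in> real_algebra" "norm x < 1"
  shows "(1/2) *\<^sub>R x \<in> convex hull logarithmic_unitaries"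
proof -
  define h k where "h = real_part x" and "k = imaginary_part x"
  have nh: "norm h < 1" and nk: "norm k < 1"
    using norm_real_part[of x] norm_imaginary_part[of x] x(2) by (auto simp: h_def k_def)
  interpret h: jordan_character_contraction \<psi> h
    using nh by unfold_locales (auto simp: h_def)
  interpret k: jordan_character_contraction \<psi> k
    using nk by unfold_locales (auto simp: k_def)
  have xhk: "x = h + \<i> *\<^sub>C k" by (simp add: h_def k_def real_plus_imaginary_part)
  have "\<psi> x = complex_of_real h.t + \<i> * complex_of_real k.t"
    by (simp add: xhk \<psi>_add \<psi>_scaleC h.\<psi>_h k.\<psi>_h)
  moreover have "Im (\<psi> x) = 0" using x(1) by (simp add: real_algebra_def complex_is_Real_iff)
  ultimately have "k.t = 0" by simp
  then have "\<i> *\<^sub>C k \<in> convex hull logarithmic_unitaries" by (rule k.ii_h_in_hull)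
  moreover have "\<bar>h.t\<bar> < 1" using norm_\<psi>_le[of h] nh by (simp add: h.\<psi>_h)
  then have "h \<in> convex hull logarithmic_unitaries" by (rule h.h_in_hull)
  ultimately have "(1/2) *\<^sub>R h + (1/2) *\<^sub>R (\<i> *\<^sub>C k) \<in> convex hull logarithmic_unitaries"
    by (intro convexD[OF convex_convex_hull]) auto
  then show ?thesis by (simp add: xhk scaleR_add_right)
qed

lemma half_ball_in_closed_hull:
  assumes x: "x \<in> real_algebra" "norm x \<le> 1"
  shows "(1/2) *\<^sub>R x \<in> closure (convex hull (unitaries real_algebra))"
proof -
  define X where "X n = (1/2) *\<^sub>R ((1 - inverse (real (Suc n))) *\<^sub>R x)" for n
  have "X n \<in> convex hull logarithmic_unitaries" for n
    unfolding X_def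
  proof (rule half_open_ball_in_hull)
    show "(1 - inverse (real (Suc n))) *\<^sub>R x \<in> real_algebra"
      by (rule subspace_scale[OF subspace_real_algebra x(1)])
    have "\<bar>1 - inverse (real (Suc n))\<bar> < 1" by (auto simp: abs_if divide_simps)
    then show "norm ((1 - inverse (real (Suc n))) *\<^sub>R x) < 1"
      using x(2) by (metis norm_scaleR mult_left_le abs_ge_zero order.strict_trans1)
  qed
  then have "X n \<in> convex hull (unitaries real_algebra)" for n
    using hull_mono[of logarithmic_unitaries "unitaries real_algebra" convex]
    by (auto simp: logarithmic_unitaries_def)
  moreover have "X \<longlonglongrightarrow> (1/2) *\<^sub>R ((1 - 0) *\<^sub>R x)"
    unfolding X_def by (intro tendsto_intros LIMSEQ_inverse_real_of_nat)
  ultimately show ?thesis unfolding closure_sequential by auto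
qed

text \<open>Extremality holds against perturbations from the whole algebra, in particular from
  \<open>real_algebra\<close>; the half ball supplies \<open>\<delta> = 1/2\<close>.\<close>

lemma strong_mankiewicz_real_algebra:
  assumes "convex_body real_algebra K"
  shows "strong_mankiewicz TYPE('b::real_normed_vector) K"
proof (rule strong_mankiewicz_if_ball_in_convex_hull_of_extreme[OF subspace_real_algebra _ _ _ _ assms])
  show "u \<in> real_algebra \<and> norm u \<le> 1" if "u \<in> logarithmic_unitaries" for u
    using that by (simp add: logarithmic_unitaries_def unitaries_def)
  show "z = 0" if "u \<in> logarithmic_unitaries" "norm (u + z) \<le> 1" "norm (u - z) \<le> 1" for u z
    using that has_small_logarithm_extreme by (auto simp: logarithmic_unitaries_def)
  show "w \<in> convex hull logarithmic_unitaries" if "w \<in> real_algebra" "norm w < 1/2" for w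
    using half_open_ball_in_hull[of "2 *\<^sub>R w"] that subspace_scale[OF subspace_real_algebra that(1)] by simp
qed simp

end

theorem proposition3p5:
  fixes \<psi> :: "'a::unital_jb_star_algebra \<Rightarrow> complex"
  assumes "jordan_star_hom \<psi>"
    and "\<psi> \<noteq> (\<lambda>_. 0)"
  shows "real_jb_star_algebra (\<psi> -` \<real>) \<and> 1 \<in> \<psi> -` \<real> \<and>
    (\<lambda>x. (1/2) *\<^sub>R x) ` (cball 0 1 \<inter> \<psi> -` \<real>)
      \<subseteq> closure (convex hull (unitaries (\<psi> -` \<real>))) \<and>
    (\<forall>K. convex_body (\<psi> -` \<real>) K \<longrightarrow> strong_mankiewicz TYPE('b::real_normed_vector) K)"
proof -
  interpret jordan_character \<psi> by unfold_locales (fact assms)+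
  show ?thesis
    using real_jb_star_algebra_real_algebra half_ball_in_closed_hull strong_mankiewicz_real_algebra
    unfolding real_algebra_def by (auto simp: \<psi>_one)
qed

end
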